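(* For every integer $n\ge 16$, we have $$\sigma(n) \le \left\lfloor \frac{\log_2(t_s(n,2))-(n-4)-\log_2((n-3)!)}{n-\log_2(16n(n-1)(n-2))}\right\rfloor +2.$$
   Context: A set $\mathcal{G}$ of planar graphs, all on the same number $n$ of vertices, is called simultaneously embeddable if there is a set $P$ of $n$ points in the plane such that every $G\in\mathcal{G}$ admits a crossing-free straight-line embedding with its vertices placed at distinct points of $P$. A conflict collection is a set of planar graphs of the same order that is not simultaneously embeddable. $\sigma(n)$ denotes the smallest size of a conflict collection of $n$-vertex planar graphs. Two labelled point sets $\{p_1,\ldots,p_n\}$ and $\{q_1,\ldots,q_n\}$ in the plane are isomorphic if for all $1\le i,j,k\le n$ the orientations (sign of $\det\begin{pmatrix}1&1&1\\ a_1&b_1&c_1\\ a_2&b_2&c_2\end{pmatrix}$ for the triple $a,b,c$) of $p_ip_jp_k$ and $q_iq_jq_k$ coincide; the equivalence classes are labelled order types. $t_s(n,2)$ denotes the number of simple labelled order types of $n$ points in the plane, i.e. those of $n$-point sets in general position (no three points collinear). *)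

theory Defs
  imports "HOL-Analysis.Analysis" "HOL-Library.Extended_Real"
begin

type_synonym plane = "real ^ 2"

type_synonym 'v graph = "'v set \<times> 'v set set"

definition simple_graph :: "'v graph \<Rightarrow> bool" where
  "simple_graph = (\<lambda>(V, E). finite V \<and> (\<forall>e\<in>E. e \<subseteq> V \<and> card e = 2))"

(* p places the vertices and c assigns to every edge the point set of the curve drawing it.
   An edge meets vertex positions only in its own endpoints, and two edges meet only in the
   positions of their common endpoints. *)
definition plane_drawing :: "'v graph \<Rightarrow> ('v \<Rightarrow> plane) \<Rightarrow> ('v set \<Rightarrow> plane set) \<Rightarrow> bool" where
  "plane_drawing = (\<lambda>(V, E) p c.
     inj_on p V \<and>
     (\<forall>e\<in>E. \<exists>g. arc g \<and> {pathstart g, pathfinish g} = p ` e \<and> path_image g = c e) \<and>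
     (\<forall>e\<in>E. c e \<inter> p ` V = p ` e) \<and>
     (\<forall>e\<in>E. \<forall>f\<in>E. e \<noteq> f \<longrightarrow> c e \<inter> c f = p ` (e \<inter> f)))"

definition planar_graph :: "'v graph \<Rightarrow> bool" where
  "planar_graph G \<longleftrightarrow> simple_graph G \<and> (\<exists>p c. plane_drawing G p c)"

(* The convex hull of the images of the two endpoints is the straight segment joining them. *)
definition straight_line_embedding :: "'v graph \<Rightarrow> ('v \<Rightarrow> plane) \<Rightarrow> bool" where
  "straight_line_embedding G p \<longleftrightarrow> plane_drawing G p (\<lambda>e. convex hull (p ` e))"

definition simultaneously_embeddable :: "nat \<Rightarrow> 'v graph set \<Rightarrow> bool" where
  "simultaneously_embeddable n \<G> \<longleftrightarrow>
     (\<exists>P. finite P \<and> card P = n \<and>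
        (\<forall>G\<in>\<G>. \<exists>p. p ` fst G \<subseteq> P \<and> straight_line_embedding G p))"

definition conflict_collection :: "nat \<Rightarrow> 'v graph set \<Rightarrow> bool" where
  "conflict_collection n \<G> \<longleftrightarrow>
     (\<forall>G\<in>\<G>. planar_graph G \<and> card (fst G) = n) \<and> \<not> simultaneously_embeddable n \<G>"

(* The value is infinity if no finite conflict collection exists. Isomorphic graphs count as
   different members of a collection; this does not affect the minimum, as dropping an
   isomorphic copy does not affect simultaneous embeddability. *)
definition conflict_sigma :: "nat \<Rightarrow> enat" where
  "conflict_sigma n = (INF \<G> \<in> {\<G> :: nat graph set. finite \<G> \<and> conflict_collection n \<G>}. enat (card \<G>))"

definition orientation :: "plane \<Rightarrow> plane \<Rightarrow> plane \<Rightarrow> real" where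
  "orientation a b c =
     sgn (det (vector [vector [1, 1, 1],
                       vector [a $ 1, b $ 1, c $ 1],
                       vector [a $ 2, b $ 2, c $ 2]] :: real ^ 3 ^ 3))"

definition labelled_point_sets :: "nat \<Rightarrow> (nat \<Rightarrow> plane) set" where
  "labelled_point_sets n = {p \<in> {1..n} \<rightarrow>\<^sub>E UNIV. inj_on p {1..n}}"

definition isomorphic_point_sets :: "nat \<Rightarrow> ((nat \<Rightarrow> plane) \<times> (nat \<Rightarrow> plane)) set" where
  "isomorphic_point_sets n =
     {(p, q). p \<in> labelled_point_sets n \<and> q \<in> labelled_point_sets n \<and>
        (\<forall>i\<in>{1..n}. \<forall>j\<in>{1..n}. \<forall>k\<in>{1..n}.
           orientation (p i) (p j) (p k) = orientation (q i) (q j) (q k))}"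

definition general_position :: "plane set \<Rightarrow> bool" where
  "general_position S \<longleftrightarrow> (\<forall>T\<subseteq>S. card T = 3 \<longrightarrow> \<not> collinear T)"

definition simple_labelled_order_types :: "nat \<Rightarrow> (nat \<Rightarrow> plane) set set" where
  "simple_labelled_order_types n =
     {p \<in> labelled_point_sets n. general_position (p ` {1..n})} // isomorphic_point_sets n"

definition t_s :: "nat \<Rightarrow> nat" where
  "t_s n = card (simple_labelled_order_types n)"

end

(* A labelled stacked triangulation on {1..n} arises from K4 on {1..4} by placing each further
   vertex into one of the 2m - 4 faces (the outer face included) of the triangulation on
   {1..m}; there are 2^(n-4) (n-3)! of them. A placement p of the labels in general position is a
   straight-line drawing of at most one of them: once the first m vertices are drawn, the position
   of vertex m + 1 lies in a single face, and its three neighbours must be the corners of that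
   face. Hence, if k triangulations embed on a common point set, then they are determined by
   the order type of the points, labelled by the first embedding, together with the k - 1
   permutations that lead from the first embedding to the others. If every k-tuple were
   simultaneously embeddable, this would give (2^(n-4) (n-3)!)^k <= t_s(n) (n!)^(k-1), which
   fails for the value of k in the theorem. Degenerate point sets are first perturbed into general
   position. *)

theory Submission
  imports Defs
begin

section \<open>Points in general position\<close>

text \<open>Write N = 2^(n-4) (n-3)!. Since n! = n (n-1) (n-2) (n-3)! and 16 = 2^4, the denominator
  in the theorem is log_2(N / n!), and the numerator is log_2(t_s(n) / N). If X is their quotient,
  the counting inequality for k = j + 1 graphs fails exactly when j > X. The least such j is
  floor(X) + 1, which explains the summand 2.

  Faces are treated combinatorially, as triples of labels, and a drawing enters only through the
  convex hulls of triples. The obstacle is that the placement decides which triple is the outer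
  face. The invariant \<open>encloses\<close> therefore speaks of some outer triple
  \<open>Q\<close>, and the laborious case is a new vertex outside \<open>Q\<close>, which swallows
  a corner of \<open>Q\<close>.

  A conflict collection must also consist of planar graphs, so every stacked triangulation has to be
  drawn. The same invariant serves there: no edge enters the interior of an inner face, so its
  centroid can be joined to the corners, and the outer face is served by a point beyond a
  corner.\<close>

definition in_general_position :: "('a \<Rightarrow> plane) \<Rightarrow> 'a set \<Rightarrow> bool" where
  "in_general_position p V \<longleftrightarrow> (\<forall>T\<subseteq>V. card T = 3 \<longrightarrow> \<not> collinear (p ` T))"

text \<open>Only vertex-disjoint edges are constrained; edges with a common end are controlled by
  general position. In this form the condition survives small perturbations and, for points in
  general position, depends on orientations alone.\<close>

definition noncrossing :: "('a \<Rightarrow> plane) \<Rightarrow> 'a set set \<Rightarrow> bool" where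
  "noncrossing p E \<longleftrightarrow>
     (\<forall>e\<in>E. \<forall>f\<in>E. e \<inter> f = {} \<longrightarrow> convex hull (p ` e) \<inter> convex hull (p ` f) = {})"

lemma in_general_position_mono:
  "in_general_position p W \<Longrightarrow> V \<subseteq> W \<Longrightarrow> in_general_position p V"
  unfolding in_general_position_def by blast

lemma noncrossing_mono: "noncrossing p E' \<Longrightarrow> E \<subseteq> E' \<Longrightarrow> noncrossing p E"
  unfolding noncrossing_def by blast

lemma noncrossingD:
  "noncrossing p E \<Longrightarrow> e \<in> E \<Longrightarrow> f \<in> E \<Longrightarrow> e \<inter> f = {} \<Longrightarrow>
    convex hull (p ` e) \<inter> convex hull (p ` f) = {}"
  unfolding noncrossing_def by blast

lemma noncrossing_cong:
  assumes "\<And>i. i \<in> V \<Longrightarrow> p i = q i" "\<And>e. e \<in> E \<Longrightarrow> e \<subseteq> V"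
  shows "noncrossing p E \<longleftrightarrow> noncrossing q E"
proof -
  have "p ` e = q ` e" if "e \<in> E" for e
    using assms(1) assms(2)[OF that] by (intro image_cong) auto
  then show ?thesis unfolding noncrossing_def by simp
qed

lemma in_general_position_cong:
  assumes "\<And>i. i \<in> V \<Longrightarrow> p i = q i"
  shows "in_general_position p V \<longleftrightarrow> in_general_position q V"
proof -
  have "p ` T = q ` T" if "T \<subseteq> V" for T
    using assms that by (intro image_cong) auto
  then show ?thesis unfolding in_general_position_def by simp
qed

lemma general_position_not_collinear:
  assumes "in_general_position p V" "{x, y, z} \<subseteq> V" "x \<noteq> y" "x \<noteq> z" "y \<noteq> z"
  shows "\<not> collinear {p x, p y, p z}"
proof -
  have "card {x, y, z} = 3" using assms by simp
  then have "\<not> collinear (p ` {x, y, z})"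
    using assms unfolding in_general_position_def by blast
  then show ?thesis by simp
qed

lemma general_position_inj_on:
  assumes "in_general_position p V" "card V \<ge> 3"
  shows "inj_on p V"
proof (rule inj_onI, rule ccontr)
  fix x y assume xy: "x \<in> V" "y \<in> V" "p x = p y" "x \<noteq> y"
  have "\<not> V \<subseteq> {x, y}"
    using card_mono[of "{x, y}" V] assms(2) xy by auto
  then obtain z where "z \<in> V" "z \<noteq> x" "z \<noteq> y" by blast
  then have "\<not> collinear {p x, p y, p z}"
    using general_position_not_collinear[OF assms(1), of x y z] xy by blast
  then show False using xy by simp
qed

lemma general_position_affine_independent:
  assumes "in_general_position p V" "T \<subseteq> V" "card T = 3"
  shows "\<not> affine_dependent (p ` T)"
proof -
  obtain x y z where T: "T = {x, y, z}" "x \<noteq> y" "x \<noteq> z" "y \<noteq> z"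
    using assms(3) by (auto simp: card_3_iff)
  have "\<not> collinear {p x, p y, p z}"
    using general_position_not_collinear[OF assms(1), of x y z] T assms(2) by blast
  then show ?thesis using T by (simp add: collinear_3_eq_affine_dependent)
qed

lemma segment_meets_triangle_side:
  fixes S :: "plane set"
  assumes "card S = 3" "w \<in> convex hull S" "z \<notin> convex hull S"
  obtains a where "a \<in> S" "closed_segment w z \<inter> convex hull (S - {a}) \<noteq> {}"
proof -
  have "closed_segment w z \<inter> frontier (convex hull S) \<noteq> {}"
    by (rule connected_Int_frontier) (use assms in auto)
  moreover have "frontier (convex hull S) = \<Union> {convex hull (S - {a}) | a. a \<in> S}"
    by (rule frontier_of_convex_hull) (simp add: assms)
  ultimately show ?thesis using that by blast
qed

lemma general_position_segment_meets_side:
  assumes "in_general_position p V" "F \<subseteq> V" "card F = 3"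
    and "w \<in> convex hull (p ` F)" "z \<notin> convex hull (p ` F)"
  obtains x where "x \<in> F" "closed_segment w z \<inter> convex hull (p ` (F - {x})) \<noteq> {}"
proof -
  have inj: "inj_on p F"
    using general_position_inj_on[OF in_general_position_mono[OF assms(1,2)]] assms(3) by simp
  then have "card (p ` F) = 3" using assms(3) by (simp add: card_image)
  from segment_meets_triangle_side[OF this assms(4,5)] obtain a where
    a: "a \<in> p ` F" "closed_segment w z \<inter> convex hull (p ` F - {a}) \<noteq> {}" by blast
  then obtain x where x: "x \<in> F" "a = p x" by blast
  have "p ` F - {a} = p ` (F - {x})"
    using inj x by (auto simp: inj_on_def)
  then show ?thesis using that[of x] x a by simp
qed

text \<open>Radon's theorem splits the four points into two classes with meeting hulls. A split into
  pairs would be a crossing, so one class is a single point, lying in the triangle of the other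
  three.\<close>

lemma noncrossing_four_points:
  assumes gp: "in_general_position p W" and W: "card W = 4"
    and nc: "\<And>A. A \<subseteq> W \<Longrightarrow> card A = 2 \<Longrightarrow>
      convex hull (p ` A) \<inter> convex hull (p ` (W - A)) = {}"
  obtains a where "a \<in> W" "p a \<in> convex hull (p ` (W - {a}))"
proof -
  have fin: "finite W" using W by (auto intro: card_ge_0_finite)
  have inj: "inj_on p W" using general_position_inj_on[OF gp] W by simp
  have "affine_dependent (p ` W)"
    by (rule affine_dependent_biggerset) (simp_all add: fin card_image[OF inj] W)
  from Radon_partition[OF finite_imageI[OF fin] this] obtain M P where MP: "M \<inter> P = {}" "M \<union> P = p ` W"
    "convex hull M \<inter> convex hull P \<noteq> {}" by (elim exE conjE)
  define A where "A = {x\<in>W. p x \<in> M}"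
  have M: "M = p ` A" using MP(2) unfolding A_def by auto
  have "P = p ` W - M" using MP(1,2) by blast
  also have "\<dots> = p ` (W - A)" unfolding A_def by auto
  finally have P: "P = p ` (W - A)" .
  have AW: "A \<subseteq> W" unfolding A_def by blast
  have meet: "convex hull (p ` A) \<inter> convex hull (p ` (W - A)) \<noteq> {}"
    using MP(3) unfolding M P .
  have "A \<noteq> {}" "W - A \<noteq> {}"
    using meet by (metis convex_hull_empty image_empty inf_bot_left inf_bot_right)+
  moreover have fA: "finite A" using fin AW finite_subset by blast
  ultimately have "card A \<noteq> 0" "card (W - A) \<noteq> 0" using fin by simp_all
  moreover have "card A + card (W - A) = 4"
    using W card_Diff_subset[OF fA AW] card_mono[OF fin AW] by simp
  moreover have "card A \<noteq> 2" using nc[OF AW] meet by blast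
  ultimately have "card A = 1 \<or> card (W - A) = 1" by linarith
  then show ?thesis
  proof
    assume "card A = 1"
    then obtain a where a: "A = {a}" by (rule card_1_singletonE)
    have "p a \<in> convex hull (p ` (W - {a}))" using meet unfolding a by simp
    then show ?thesis using that a AW by blast
  next
    assume "card (W - A) = 1"
    then obtain a where a: "W - A = {a}" by (rule card_1_singletonE)
    then have A: "A = W - {a}" using AW by blast
    have "p a \<in> convex hull (p ` (W - {a}))" using meet unfolding a unfolding A by simp
    then show ?thesis using that a by blast
  qed
qed

text \<open>A corner is an extreme point of the large triangle, hence of the smaller one if it lies
  there; but the extreme points of a hull are among its generators.\<close>

lemma vertex_not_in_subtriangle:
  assumes gp: "in_general_position p V" and F: "F \<subseteq> V" "card F = 3" "x \<in> F"
    and v: "v \<in> V" "v \<notin> F" "p v \<in> convex hull (p ` F)"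
    and inj: "inj_on p V"
  shows "p x \<notin> convex hull (p ` insert v (F - {x}))"
proof
  assume x: "p x \<in> convex hull (p ` insert v (F - {x}))"
  have "p x extreme_point_of (convex hull (p ` F))"
    using extreme_point_of_convex_hull_affine_independent
      general_position_affine_independent[OF gp F(1,2)] F(3) by blast
  moreover have "convex hull (p ` insert v (F - {x})) \<subseteq> convex hull (p ` F)"
    by (rule hull_minimal) (use v in \<open>auto intro: hull_inc\<close>)
  ultimately have "p x extreme_point_of (convex hull (p ` insert v (F - {x})))"
    using x unfolding extreme_point_of_def by blast
  then have "p x \<in> p ` insert v (F - {x})" by (rule extreme_point_of_convex_hull)
  then show False using inj F v by (auto simp: inj_on_def)
qed

lemma triangle_subdivision:
  fixes p :: "'a \<Rightarrow> plane"
  assumes "p v \<in> convex hull (p ` F)" and inj: "inj_on p F"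
  shows "convex hull (p ` F) \<subseteq> (\<Union>x\<in>F. convex hull (p ` insert v (F - {x})))"
proof
  fix w assume "w \<in> convex hull (p ` F)"
  from in_convex_hull_exchange[OF assms(1) this] obtain b where
    b: "b \<in> p ` F" "w \<in> convex hull (insert (p v) (p ` F - {b}))" .
  then obtain x where x: "x \<in> F" "b = p x" by blast
  have "insert (p v) (p ` F - {b}) = p ` insert v (F - {x})"
    using inj x by (auto simp: inj_on_def)
  then show "w \<in> (\<Union>x\<in>F. convex hull (p ` insert v (F - {x})))" using x b by auto
qed

section \<open>Locating a point in a face\<close>

text \<open>\<open>Q\<close> plays the outer face. The last two conditions replace the decomposition
  of the plane into faces: every point inside \<open>Q\<close> lies in some inner face, and an inner
  face contains no vertices but its corners.\<close>

definition encloses :: "('a \<Rightarrow> plane) \<Rightarrow> 'a set \<Rightarrow> 'a set set \<Rightarrow> 'a set \<Rightarrow> bool" where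
  "encloses p V \<Phi> Q \<longleftrightarrow> Q \<in> \<Phi> \<and> p ` V \<subseteq> convex hull (p ` Q) \<and>
     convex hull (p ` Q) \<subseteq> (\<Union>F\<in>\<Phi> - {Q}. convex hull (p ` F)) \<and>
     (\<forall>F\<in>\<Phi> - {Q}. \<forall>i\<in>V. p i \<in> convex hull (p ` F) \<longrightarrow> i \<in> F)"

definition stack_edges :: "'a \<Rightarrow> 'a set \<Rightarrow> 'a set set \<Rightarrow> 'a set set" where
  "stack_edges v F E = E \<union> (\<lambda>x. {v, x}) ` F"

text \<open>The same rule covers stacking into the outer face; which of the resulting triples is
  then outer is left to the placement.\<close>

definition stack_faces :: "'a \<Rightarrow> 'a set \<Rightarrow> 'a set set \<Rightarrow> 'a set set" where
  "stack_faces v F \<Phi> = (\<Phi> - {F}) \<union> (\<lambda>x. insert v (F - {x})) ` F"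

lemma card3_Diff_pair:
  assumes "card F = 3" "x \<in> F"
  obtains y z where "F = {x, y, z}" "F - {x} = {y, z}" "y \<noteq> z" "y \<noteq> x" "z \<noteq> x"
proof -
  have "card (F - {x}) = 2" using assms by simp
  then obtain y z where "F - {x} = {y, z}" "y \<noteq> z" by (auto simp: card_2_iff)
  moreover have "F = insert x (F - {x})" using assms by blast
  ultimately show ?thesis using that[of y z] by blast
qed

text \<open>A side is written \<open>F - {x}\<close>, opposite to the corner \<open>x\<close>. Such
  triangles need not be faces: a face that has received a vertex remains in this set.\<close>

definition triangles_of :: "'a set \<Rightarrow> 'a set set \<Rightarrow> 'a set set" where
  "triangles_of V E = {F. F \<subseteq> V \<and> card F = 3 \<and> (\<forall>x\<in>F. F - {x} \<in> E)}"

lemma triangles_ofD: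
  assumes "F \<in> triangles_of V E"
  shows "F \<subseteq> V" "card F = 3" "x \<in> F \<Longrightarrow> F - {x} \<in> E" "finite F"
  using assms unfolding triangles_of_def by (auto intro: card_ge_0_finite)

text \<open>The edge from \<open>v\<close> to \<open>d\<close> leads from inside the triangle to
  outside and so meets a side. If \<open>d\<close> were not a corner, edge and side would share no
  vertex and would cross.\<close>

lemma neighbour_in_triangle:
  assumes gp: "in_general_position p V" and nc: "noncrossing p (stack_edges v N E)"
    and F: "F \<in> triangles_of V E" and v: "v \<notin> V" and N: "N \<subseteq> V" "d \<in> N"
    and one: "p v \<in> convex hull (p ` F) \<and> p d \<notin> convex hull (p ` F) \<or>
      p d \<in> convex hull (p ` F) \<and> p v \<notin> convex hull (p ` F)"
  shows "d \<in> F"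
proof (rule ccontr)
  assume d: "d \<notin> F"
  note F = triangles_ofD[OF F]
  have "\<exists>x\<in>F. closed_segment (p v) (p d) \<inter> convex hull (p ` (F - {x})) \<noteq> {}"
    using one
  proof
    assume "p v \<in> convex hull (p ` F) \<and> p d \<notin> convex hull (p ` F)"
    then show ?thesis
      using general_position_segment_meets_side[OF gp F(1,2), of "p v" "p d"] by blast
  next
    assume "p d \<in> convex hull (p ` F) \<and> p v \<notin> convex hull (p ` F)"
    then show ?thesis
      using general_position_segment_meets_side[OF gp F(1,2), of "p d" "p v"]
      unfolding closed_segment_commute[of "p d" "p v"] by blast
  qed
  then obtain x where x: "x \<in> F" "closed_segment (p v) (p d) \<inter> convex hull (p ` (F - {x})) \<noteq> {}"
    by blast
  moreover have "{v, d} \<inter> (F - {x}) = {}" using d v F by auto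
  moreover have "{v, d} \<in> stack_edges v N E" "F - {x} \<in> stack_edges v N E"
    using N F(3)[OF x(1)] unfolding stack_edges_def by auto
  ultimately show False
    using noncrossingD[OF nc, of "{v, d}" "F - {x}"] by (simp add: segment_convex_hull)
qed

text \<open>A neighbour of \<open>v\<close> inside the triangle is a corner because inner faces
  contain no other vertices; a neighbour outside it is a corner by the crossing argument. Hence the
  three neighbours are the three corners.\<close>

lemma located_in_inner_face:
  assumes gp: "in_general_position p V" and nc: "noncrossing p (stack_edges v N E)"
    and \<Phi>: "\<Phi> \<subseteq> triangles_of V E" and v: "v \<notin> V" and enc: "encloses p V \<Phi> Q"
    and N: "N \<in> \<Phi>" and F: "F \<in> \<Phi> - {Q}" "p v \<in> convex hull (p ` F)"
  shows "F = N"
proof -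
  have NV: "N \<subseteq> V" "card N = 3" using N \<Phi> triangles_ofD by blast+
  have FV: "F \<in> triangles_of V E" "card F = 3" "finite F"
    using F \<Phi> triangles_ofD(2,4) by blast+
  have "d \<in> F" if "d \<in> N" for d
  proof (cases "p d \<in> convex hull (p ` F)")
    case True
    then show ?thesis using enc F NV that unfolding encloses_def by blast
  next
    case False
    then show ?thesis using neighbour_in_triangle[OF gp nc FV(1) v NV(1) that] F by blast
  qed
  then have "N \<subseteq> F" by blast
  then show ?thesis using card_subset_eq[of F N] FV NV by simp
qed

text \<open>All old vertices lie in the triangle \<open>Q\<close> and \<open>v\<close> does not, so
  every edge at \<open>v\<close> has to enter \<open>Q\<close> from outside.\<close>

lemma located_in_outer_face:
  assumes gp: "in_general_position p V" and nc: "noncrossing p (stack_edges v N E)"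
    and \<Phi>: "\<Phi> \<subseteq> triangles_of V E" and v: "v \<notin> V" and enc: "encloses p V \<Phi> Q"
    and N: "N \<in> \<Phi>" and out: "p v \<notin> convex hull (p ` Q)"
  shows "N = Q"
proof -
  have NV: "N \<subseteq> V" "card N = 3" using N \<Phi> triangles_ofD by blast+
  have Q: "Q \<in> triangles_of V E" "card Q = 3" "finite Q"
    using enc \<Phi> triangles_ofD(2,4) unfolding encloses_def by blast+
  have "d \<in> Q" if "d \<in> N" for d
    using neighbour_in_triangle[OF gp nc Q(1) v NV(1) that] out enc that NV
    unfolding encloses_def by blast
  then have "N \<subseteq> Q" by blast
  then show ?thesis using card_subset_eq[of Q N] Q NV by simp
qed

lemma stacking_face_unique:
  assumes gp: "in_general_position p V"
    and nc: "noncrossing p (stack_edges v N E)" "noncrossing p (stack_edges v N' E)"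
    and \<Phi>: "\<Phi> \<subseteq> triangles_of V E" and v: "v \<notin> V" and enc: "encloses p V \<Phi> Q"
    and N: "N \<in> \<Phi>" "N' \<in> \<Phi>"
  shows "N = N'"
proof (cases "p v \<in> convex hull (p ` Q)")
  case True
  then obtain F where F: "F \<in> \<Phi> - {Q}" "p v \<in> convex hull (p ` F)"
    using enc unfolding encloses_def by blast
  then show ?thesis
    using located_in_inner_face[OF gp nc(1) \<Phi> v enc N(1) F]
      located_in_inner_face[OF gp nc(2) \<Phi> v enc N(2) F] by simp
next
  case False
  then show ?thesis
    using located_in_outer_face[OF gp nc(1) \<Phi> v enc N(1)]
      located_in_outer_face[OF gp nc(2) \<Phi> v enc N(2)] by simp
qed

lemma general_position_in_segment:
  assumes gp: "in_general_position p V" and "{x, y, i} \<subseteq> V"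
    and i: "p i \<in> closed_segment (p x) (p y)" and "card V \<ge> 3"
  shows "i = x \<or> i = y"
proof (rule ccontr)
  assume ne: "\<not> (i = x \<or> i = y)"
  show False
  proof (cases "x = y")
    case True
    then show False
      using general_position_inj_on[OF gp] assms ne by (auto simp: inj_on_def)
  next
    case False
    have "collinear {p x, p i, p y}"
      using i by (intro between_imp_collinear) (simp add: between_mem_segment)
    then show False
      using general_position_not_collinear[OF gp, of x i y] assms ne False by auto
  qed
qed

section \<open>Outer triangles and their behaviour under stacking\<close>

lemma encloses_four_points:
  assumes gp: "in_general_position p W" and W: "card W = 4"
    and nc: "noncrossing p {e. e \<subseteq> W \<and> card e = 2}"
  shows "\<exists>Q. encloses p W {F. F \<subseteq> W \<and> card F = 3} Q"
proof -
  have fin: "finite W" using W by (auto intro: card_ge_0_finite)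
  have inj: "inj_on p W" using general_position_inj_on[OF gp] W by simp
  have "convex hull (p ` A) \<inter> convex hull (p ` (W - A)) = {}" if "A \<subseteq> W" "card A = 2" for A
    by (rule noncrossingD[OF nc]) (use that W fin in \<open>auto simp: card_Diff_subset finite_subset\<close>)
  from noncrossing_four_points[OF gp W this] obtain a where
    a: "a \<in> W" "p a \<in> convex hull (p ` (W - {a}))" by blast
  define Q where "Q = W - {a}"
  have Q: "Q \<subseteq> W" "card Q = 3" "a \<notin> Q" "insert a Q = W"
    using a W fin unfolding Q_def by auto
  have aQ: "p a \<in> convex hull (p ` Q)" using a unfolding Q_def by simp
  have card_sub: "card (insert a (Q - {x})) = 3" if "x \<in> Q" for x
    using Q that card_ge_0_finite[of Q] by (simp add: card_Diff_singleton)
  \<comment> \<open>A triple other than \<open>Q\<close> omits exactly one label, and that label is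
    not \<open>a\<close>; so the inner faces are the three triangles into which \<open>a\<close>
    cuts \<open>Q\<close>.\<close>
  have "\<exists>x\<in>Q. F = insert a (Q - {x})" if "F \<subseteq> W" "card F = 3" "F \<noteq> Q" for F
  proof -
    have "card (W - F) = 1"
      using that W fin by (simp add: card_Diff_subset finite_subset)
    then obtain x where x: "W - F = {x}" by (rule card_1_singletonE)
    then have F: "F = W - {x}" using that by blast
    then have "x \<noteq> a" using that unfolding Q_def by blast
    then have "x \<in> Q" "F = insert a (Q - {x})" using x F Q by auto
    then show ?thesis by blast
  qed
  moreover have "insert a (Q - {x}) \<subseteq> W" for x using Q by blast
  ultimately have faces: "{F. F \<subseteq> W \<and> card F = 3} - {Q} = (\<lambda>x. insert a (Q - {x})) ` Q"
    using card_sub Q(3) by blast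
  have "encloses p W {F. F \<subseteq> W \<and> card F = 3} Q"
    unfolding encloses_def faces
  proof (intro conjI ballI impI)
    show "Q \<in> {F. F \<subseteq> W \<and> card F = 3}" using Q by simp
    show "p ` W \<subseteq> convex hull (p ` Q)"
      using aQ Q(4) hull_subset[of "p ` Q" convex] by (metis image_insert insert_subset)
    show "convex hull (p ` Q) \<subseteq> (\<Union>F\<in>(\<lambda>x. insert a (Q - {x})) ` Q. convex hull (p ` F))"
      using triangle_subdivision[OF aQ inj_on_subset[OF inj Q(1)]] by simp
  next
    fix F i assume F: "F \<in> (\<lambda>x. insert a (Q - {x})) ` Q" and i: "i \<in> W" "p i \<in> convex hull (p ` F)"
    then obtain x where x: "x \<in> Q" "F = insert a (Q - {x})" by blast
    then have "i \<noteq> x" using vertex_not_in_subtriangle[OF gp Q(1,2) x(1) a(1) Q(3) aQ inj] i by blast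
    then show "i \<in> F" using x i Q by blast
  qed
  then show ?thesis by blast
qed

lemma stack_faces_old: "F \<in> \<Phi> \<Longrightarrow> F \<noteq> N \<Longrightarrow> F \<in> stack_faces v N \<Phi>"
  unfolding stack_faces_def by blast

lemma stack_faces_new: "x \<in> N \<Longrightarrow> insert v (N - {x}) \<in> stack_faces v N \<Phi>"
  unfolding stack_faces_def by blast

lemma enclosesD:
  assumes "encloses p V \<Phi> Q"
  shows "Q \<in> \<Phi>" "p ` V \<subseteq> convex hull (p ` Q)"
    "convex hull (p ` Q) \<subseteq> (\<Union>F\<in>\<Phi> - {Q}. convex hull (p ` F))"
    "F \<in> \<Phi> \<Longrightarrow> F \<noteq> Q \<Longrightarrow> i \<in> V \<Longrightarrow> p i \<in> convex hull (p ` F) \<Longrightarrow> i \<in> F"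
  using assms unfolding encloses_def by (blast, blast, blast, blast)

text \<open>If \<open>v\<close> falls inside \<open>Q\<close>, the outer triangle stays and the face
  around \<open>v\<close> is cut into three. If \<open>v\<close> falls outside, it is stacked into
  \<open>Q\<close> itself, and the new edges force one corner of \<open>Q\<close> into the triangle
  of \<open>v\<close> and the other two corners, which becomes the outer triangle.\<close>

lemma encloses_stack:
  assumes gp: "in_general_position p (insert v V)" and nc: "noncrossing p (stack_edges v N E)"
    and \<Phi>: "\<Phi> \<subseteq> triangles_of V E" and v: "v \<notin> V" and enc: "encloses p V \<Phi> Q"
    and N: "N \<in> \<Phi>" and fin: "finite V"
  shows "\<exists>Q'. encloses p (insert v V) (stack_faces v N \<Phi>) Q'"
proof -
  have gpV: "in_general_position p V"
    using in_general_position_mono[OF gp] by blast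
  note VQ = enclosesD(2)[OF enc] and cover = enclosesD(3)[OF enc]
  have sub: "F \<subseteq> V" "v \<notin> F" "card F = 3" "finite F" if "F \<in> \<Phi>" for F
  proof -
    have "F \<in> triangles_of V E" using that \<Phi> by blast
    note F = triangles_ofD[OF this]
    show "F \<subseteq> V" "v \<notin> F" "card F = 3" "finite F" using F v by auto
  qed
  have Q: "Q \<in> \<Phi>" "Q \<subseteq> V" "card Q = 3" "v \<notin> Q" "finite Q"
    using enclosesD(1)[OF enc] sub[OF enclosesD(1)[OF enc]] by simp_all
  have N': "N \<subseteq> V" "card N = 3" "v \<notin> N" using sub[OF N] by simp_all
  have "card V \<ge> 3" using card_mono[OF fin Q(2)] Q(3) by simp
  then have "card (insert v V) \<ge> 3" using fin v by simp
  then have inj: "inj_on p (insert v V)" using general_position_inj_on[OF gp] by blast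
  show ?thesis
  proof (cases "p v \<in> convex hull (p ` Q)")
    case True
    then obtain F where F: "F \<in> \<Phi> - {Q}" "p v \<in> convex hull (p ` F)"
      using cover by blast
    have NQ: "N \<noteq> Q" and vN: "p v \<in> convex hull (p ` N)"
      using located_in_inner_face[OF gpV nc \<Phi> v enc N F] F by auto
    have "encloses p (insert v V) (stack_faces v N \<Phi>) Q"
      unfolding encloses_def
    proof (intro conjI ballI impI)
      show "Q \<in> stack_faces v N \<Phi>" using Q NQ unfolding stack_faces_def by blast
      show "p ` insert v V \<subseteq> convex hull (p ` Q)" using VQ True by simp
      show "convex hull (p ` Q) \<subseteq> (\<Union>F\<in>stack_faces v N \<Phi> - {Q}. convex hull (p ` F))"
      proof
        fix w assume "w \<in> convex hull (p ` Q)"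
        then obtain F where F: "F \<in> \<Phi> - {Q}" "w \<in> convex hull (p ` F)" using cover by blast
        have "\<exists>F\<in>stack_faces v N \<Phi> - {Q}. w \<in> convex hull (p ` F)"
        proof (cases "F = N")
          case False
          then have "F \<in> stack_faces v N \<Phi> - {Q}"
            using F stack_faces_old[of F \<Phi> N v] by simp
          then show ?thesis using F(2) by (intro bexI)
        next
          case True
          then obtain x where "x \<in> N" "w \<in> convex hull (p ` insert v (N - {x}))"
            using triangle_subdivision[OF vN inj_on_subset[OF inj]] N' F by blast
          moreover from \<open>x \<in> N\<close> have "insert v (N - {x}) \<in> stack_faces v N \<Phi> - {Q}"
            using Q(4) stack_faces_new[of x N v \<Phi>] by auto
          ultimately show ?thesis by (intro bexI)
        qed
        then show "w \<in> (\<Union>F\<in>stack_faces v N \<Phi> - {Q}. convex hull (p ` F))" by blast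
      qed
    next
      fix F i assume F: "F \<in> stack_faces v N \<Phi> - {Q}" and i: "i \<in> insert v V" "p i \<in> convex hull (p ` F)"
      show "i \<in> F"
      proof (cases "F \<in> \<Phi> - {N}")
        case True
        \<comment> \<open>An old inner face other than \<open>N\<close> cannot contain the new
          point, since location would identify it with \<open>N\<close>.\<close>
        then have "i \<noteq> v" using located_in_inner_face[OF gpV nc \<Phi> v enc N, of F] F i by blast
        then show ?thesis using enclosesD(4)[OF enc] i True F by blast
      next
        case False
        then obtain x where x: "x \<in> N" "F = insert v (N - {x})"
          using F unfolding stack_faces_def by blast
        have "convex hull (p ` F) \<subseteq> convex hull (p ` N)"
          by (rule hull_minimal) (use vN x in \<open>auto intro: hull_inc\<close>)
        then have "i = v \<or> i \<in> N" using enclosesD(4)[OF enc N NQ] i by blast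
        moreover have "i \<noteq> x"
          using vertex_not_in_subtriangle[OF gp _ N'(2) x(1) _ N'(3) vN inj] i N' x by blast
        ultimately show ?thesis using x by blast
      qed
    qed
    then show ?thesis by blast
  next
    case False
    have NQ: "N = Q" using located_in_outer_face[OF gpV nc \<Phi> v enc N False] .
    have star: "convex hull (p ` {v, x}) \<inter> convex hull (p ` (Q - {x})) = {}" if "x \<in> Q" for x
      by (rule noncrossingD[OF nc])
        (use that Q \<Phi> triangles_ofD(3)[of Q V E x] NQ in \<open>auto simp: stack_edges_def\<close>)
    define W where "W = insert v Q"
    have W: "card W = 4" "W \<subseteq> insert v V" using Q unfolding W_def by auto
    \<comment> \<open>A split of \<open>W\<close> into pairs consists of a new edge
      \<open>{v, x}\<close> and the opposite side \<open>Q - {x}\<close>, so \<open>star\<close>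
      excludes every crossing.\<close>
    have "convex hull (p ` A) \<inter> convex hull (p ` (W - A)) = {}" if A: "A \<subseteq> W" "card A = 2" for A
    proof (cases "v \<in> A")
      case True
      then obtain x where x: "A = {v, x}" "x \<noteq> v" using A by (auto simp: card_2_iff)
      then have "x \<in> Q" "W - A = Q - {x}" using A Q unfolding W_def by auto
      then show ?thesis using star x by simp
    next
      case False
      then have AQ: "A \<subseteq> Q" using A unfolding W_def by blast
      then have "card (Q - A) = 1" using A Q by (simp add: card_Diff_subset finite_subset)
      then obtain x where x: "Q - A = {x}" by (rule card_1_singletonE)
      then have "x \<in> Q" "W - A = {v, x}" "A = Q - {x}" using AQ False unfolding W_def by auto
      then show ?thesis using star[of x] by (simp add: Int_commute)
    qed
    from noncrossing_four_points[OF in_general_position_mono[OF gp W(2)] W(1) this]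
    obtain a where a: "a \<in> W" "p a \<in> convex hull (p ` (W - {a}))" by blast
    have "a \<noteq> v"
    proof
      assume "a = v"
      moreover have "W - {v} = Q" using Q unfolding W_def by auto
      ultimately show "False" using a False by simp
    qed
    then have aQ: "a \<in> Q" using a unfolding W_def by blast
    define Q' where "Q' = insert v (Q - {a})"
    have WQ': "W - {a} = Q'" using \<open>a \<noteq> v\<close> unfolding W_def Q'_def by blast
    then have aQ': "p a \<in> convex hull (p ` Q')" using a by simp
    have Q': "Q' \<subseteq> insert v V" "a \<notin> Q'" "card Q' = 3"
      using Q aQ \<open>a \<noteq> v\<close> unfolding Q'_def by (auto simp: card_Diff_singleton)
    have "p ` Q \<subseteq> convex hull (p ` Q')"
    proof
      fix w assume "w \<in> p ` Q"
      then obtain x where x: "x \<in> Q" "w = p x" by blast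
      then have "x = a \<or> x \<in> Q'" unfolding Q'_def by blast
      then show "w \<in> convex hull (p ` Q')" using aQ' x by (auto intro: hull_inc)
    qed
    then have QQ': "convex hull (p ` Q) \<subseteq> convex hull (p ` Q')" by (rule hull_minimal) simp
    \<comment> \<open>\<open>Q'\<close> is cut into three triangles from the point \<open>a\<close>
      inside it: the one opposite \<open>v\<close> is the former outer triangle, already covered by
      old faces, and the other two are new faces.\<close>
    have split: "insert a (Q' - {x}) = (if x = v then Q else insert v (Q - {x}))" if "x \<in> Q'" for x
      using that aQ Q \<open>a \<noteq> v\<close> unfolding Q'_def by auto
    have "encloses p (insert v V) (stack_faces v N \<Phi>) Q'"
      unfolding encloses_def
    proof (intro conjI ballI impI)
      show "Q' \<in> stack_faces v N \<Phi>" using aQ NQ unfolding stack_faces_def Q'_def by blast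
      show "p ` insert v V \<subseteq> convex hull (p ` Q')"
        using VQ QQ' hull_inc[of "p v" "p ` Q'" convex] unfolding Q'_def by auto
      show "convex hull (p ` Q') \<subseteq> (\<Union>F\<in>stack_faces v N \<Phi> - {Q'}. convex hull (p ` F))"
      proof
        fix w assume "w \<in> convex hull (p ` Q')"
        then obtain x where x: "x \<in> Q'" "w \<in> convex hull (p ` insert a (Q' - {x}))"
          using triangle_subdivision[OF aQ' inj_on_subset[OF inj Q'(1)]] by blast
        have "\<exists>F\<in>stack_faces v N \<Phi> - {Q'}. w \<in> convex hull (p ` F)"
        proof (cases "x = v")
          case True
          then have eq: "insert a (Q' - {x}) = Q" using split[OF x(1)] by simp
          have "w \<in> convex hull (p ` Q)" using x(2) unfolding eq .
          then obtain F where F: "F \<in> \<Phi> - {Q}" "w \<in> convex hull (p ` F)" using cover by blast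
          moreover have "F \<noteq> Q'" using F(1) sub(2) unfolding Q'_def by blast
          ultimately have "F \<in> stack_faces v N \<Phi> - {Q'}"
            using NQ stack_faces_old[of F \<Phi> N v] by simp
          then show ?thesis using F(2) by (intro bexI)
        next
          case False
          then have eq: "insert a (Q' - {x}) = insert v (Q - {x})" and "x \<in> Q"
            using split[OF x(1)] x(1) unfolding Q'_def by auto
          have "w \<in> convex hull (p ` insert v (Q - {x}))" using x(2) unfolding eq .
          moreover have "insert v (Q - {x}) \<in> stack_faces v N \<Phi>"
            using NQ \<open>x \<in> Q\<close> stack_faces_new[of x N v \<Phi>] by simp
          moreover have "insert v (Q - {x}) \<noteq> Q'" using eq Q'(2) by blast
          ultimately show ?thesis by (intro bexI[of _ "insert v (Q - {x})"]) simp_all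
        qed
        then show "w \<in> (\<Union>F\<in>stack_faces v N \<Phi> - {Q'}. convex hull (p ` F))" by blast
      qed
    next
      fix F i assume F: "F \<in> stack_faces v N \<Phi> - {Q'}" and i: "i \<in> insert v V" "p i \<in> convex hull (p ` F)"
      show "i \<in> F"
      proof (cases "F \<in> \<Phi> - {N}")
        case True
        have "F \<subseteq> V" using True sub(1) by blast
        then have "convex hull (p ` F) \<subseteq> convex hull (p ` Q)"
          using VQ by (intro hull_minimal) auto
        then have "i \<noteq> v" using False i by blast
        then show ?thesis using enclosesD(4)[OF enc] i True NQ by blast
      next
        case nF: False
        then obtain x where x: "x \<in> Q" "F = insert v (Q - {x})"
          using F NQ unfolding stack_faces_def by blast
        then have xa: "x \<noteq> a" using F unfolding Q'_def by blast
        show ?thesis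
        proof (cases "i = v")
          case True
          then show ?thesis using x by simp
        next
          case iv: False
          \<comment> \<open>\<open>F\<close> and \<open>Q\<close> are both triangles at
            \<open>a\<close> in the subdivision of \<open>Q'\<close>, so they meet only in the hull
            of their common corners, the side \<open>Q - {x}\<close>. General position leaves only
            the ends of that side for \<open>i\<close>.\<close>
          then have "p i \<in> convex hull (p ` Q)" using i VQ by blast
          also have "p ` Q = insert (p a) (p ` (Q - {a}))" using aQ by blast
          finally have 1: "p i \<in> convex hull (insert (p a) (p ` (Q - {a})))" .
          have "F = insert a (F - {a})" using x aQ xa by blast
          then have "p ` F = insert (p a) (p ` (F - {a}))" by (metis image_insert)
          then have 2: "p i \<in> convex hull (insert (p a) (p ` (F - {a})))" using i by simp
          have subs: "p ` (Q - {a}) \<subseteq> p ` Q'" "p ` (F - {a}) \<subseteq> p ` Q'"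
            using x unfolding Q'_def by auto
          have "p ` (Q - {a}) \<inter> p ` (F - {a}) = p ` ((Q - {a}) \<inter> (F - {a}))"
            by (rule inj_on_image_Int[OF inj, symmetric]) (use Q x in auto)
          also have "(Q - {a}) \<inter> (F - {a}) = Q - {x} - {a}"
            using x Q by auto
          finally have "p i \<in> convex hull (insert (p a) (p ` (Q - {x} - {a})))"
            using in_convex_hull_exchange_unique
              [OF general_position_affine_independent[OF gp Q'(1,3)] aQ' subs 1 2] by simp
          moreover have "Q - {x} = insert a (Q - {x} - {a})" using aQ xa by blast
          then have "insert (p a) (p ` (Q - {x} - {a})) = p ` (Q - {x})" by (metis image_insert)
          ultimately have pi: "p i \<in> convex hull (p ` (Q - {x}))" by simp
          obtain y z where yz: "Q - {x} = {y, z}" using card3_Diff_pair[OF Q(3) x(1)] by blast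
          have "i = y \<or> i = z"
          proof (rule general_position_in_segment[OF gp])
            show "p i \<in> closed_segment (p y) (p z)" using pi yz by (simp add: segment_convex_hull)
            show "{y, z, i} \<subseteq> insert v V" using yz Q i by blast
          qed fact
          then show ?thesis using x yz by blast
        qed
      qed
    qed
    then show ?thesis by blast
  qed
qed

section \<open>Labelled stacked triangulations\<close>

inductive stacked :: "nat \<Rightarrow> nat set set \<Rightarrow> nat set set \<Rightarrow> bool" where
  base: "stacked 4 {e. e \<subseteq> {1..4} \<and> card e = 2} {F. F \<subseteq> {1..4} \<and> card F = 3}"
| step: "stacked m E \<Phi> \<Longrightarrow> F \<in> \<Phi> \<Longrightarrow>
    stacked (Suc m) (stack_edges (Suc m) F E) (stack_faces (Suc m) F \<Phi>)"

lemma stacked_ge_4: "stacked m E \<Phi> \<Longrightarrow> m \<ge> 4"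
  by (induction rule: stacked.induct) auto

lemma stack_faces_triangles:
  assumes \<Phi>: "\<Phi> \<subseteq> triangles_of V E" and N: "N \<in> \<Phi>" and v: "v \<notin> V"
  shows "stack_faces v N \<Phi> \<subseteq> triangles_of (insert v V) (stack_edges v N E)"
proof
  fix F assume "F \<in> stack_faces v N \<Phi>"
  then consider "F \<in> \<Phi>" | x where "x \<in> N" "F = insert v (N - {x})"
    unfolding stack_faces_def by blast
  then show "F \<in> triangles_of (insert v V) (stack_edges v N E)"
  proof cases
    case 1
    then show ?thesis using \<Phi> unfolding triangles_of_def stack_edges_def by blast
  next
    case (2 x)
    have "N \<in> triangles_of V E" using \<Phi> N by blast
    note N = triangles_ofD[OF this]
    obtain y z where yz: "N = {x, y, z}" "N - {x} = {y, z}" "y \<noteq> z" "y \<noteq> x" "z \<noteq> x"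
      using card3_Diff_pair[OF N(2) 2(1)] by blast
    have F: "F = {v, y, z}" using 2 yz by simp
    have "v \<notin> N" using N(1) v by blast
    then have "v \<noteq> y" "v \<noteq> z" using yz by auto
    moreover have "{y, z} \<in> E" using N(3)[of x] yz by simp
    ultimately have "F - {u} \<in> stack_edges v N E" if "u \<in> F" for u
      using that yz(1,3) unfolding F stack_edges_def by (auto simp: insert_Diff_if insert_commute)
    moreover have "card F = 3" "F \<subseteq> insert v V"
      using F yz(1,3) \<open>v \<noteq> y\<close> \<open>v \<noteq> z\<close> N(1) by auto
    ultimately show ?thesis unfolding triangles_of_def by blast
  qed
qed

lemma stacked_faces_triangles: "stacked m E \<Phi> \<Longrightarrow> \<Phi> \<subseteq> triangles_of {1..m} E"
proof (induction rule: stacked.induct)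
  case base
  have "card (F - {x}) = 2" if "card F = 3" "x \<in> F" for F :: "nat set" and x
    using that by simp
  then show ?case unfolding triangles_of_def by blast
next
  case (step m E \<Phi> F)
  have "insert (Suc m) {1..m} = {1..Suc m}" by auto
  then show ?case using stack_faces_triangles[OF step.IH step.hyps(2), of "Suc m"] by simp
qed

lemma stacked_edges:
  "stacked m E \<Phi> \<Longrightarrow> e \<in> E \<Longrightarrow> e \<subseteq> {1..m} \<and> card e = 2"
proof (induction arbitrary: e rule: stacked.induct)
  case (step m E \<Phi> F)
  have "F \<in> triangles_of {1..m} E" using stacked_faces_triangles[OF step.hyps(1)] step.hyps(2) by blast
  then have sub: "F \<subseteq> {1..m}" by (rule triangles_ofD)
  from step.prems consider "e \<in> E" | x where "x \<in> F" "e = {Suc m, x}"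
    unfolding stack_edges_def by blast
  then show ?case
  proof cases
    case 1
    then show ?thesis using step.IH[of e] by auto
  next
    case (2 x)
    then have "x \<in> {1..m}" using sub by blast
    then show ?thesis using 2 by auto
  qed
qed auto

text \<open>Each stacking trades one face for three, and these three are new since they contain the
  new label; in K4 all four triples are faces.\<close>

lemma stacked_card_faces:
  "stacked m E \<Phi> \<Longrightarrow> finite \<Phi> \<and> card \<Phi> = 2 * m - 4"
proof (induction rule: stacked.induct)
  case base
  show ?case using n_subsets[of "{1..4::nat}" 3] by (simp add: binomial_eq_0 eval_nat_numeral)
next
  case (step m E \<Phi> F)
  have F: "F \<in> triangles_of {1..m} E" if "F \<in> \<Phi>" for F
    using stacked_faces_triangles[OF step.hyps(1)] that by blast
  note FD = triangles_ofD[OF F[OF step.hyps(2)]]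
  have v: "Suc m \<notin> G" if "G \<in> \<Phi>" for G using triangles_ofD(1)[OF F[OF that]] by auto
  have "inj_on (\<lambda>x. insert (Suc m) (F - {x})) F"
  proof (rule inj_onI)
    fix x y assume xy: "x \<in> F" "y \<in> F" "insert (Suc m) (F - {x}) = insert (Suc m) (F - {y})"
    then have "F - {x} = F - {y}"
      using v[OF step.hyps(2)] insert_ident[of "Suc m" "F - {x}" "F - {y}"] by simp
    then show "x = y" using xy(1,2) by blast
  qed
  then have "card ((\<lambda>x. insert (Suc m) (F - {x})) ` F) = 3" using FD by (simp add: card_image)
  moreover have "(\<Phi> - {F}) \<inter> (\<lambda>x. insert (Suc m) (F - {x})) ` F = {}" using v by blast
  ultimately have "card (stack_faces (Suc m) F \<Phi>) = card (\<Phi> - {F}) + 3"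
    unfolding stack_faces_def using step.IH FD by (subst card_Un_disjoint) auto
  moreover have "m \<ge> 4" using stacked_ge_4[OF step.hyps(1)] .
  ultimately show ?case using step.IH step.hyps(2) FD unfolding stack_faces_def by auto
qed

section \<open>Recovering the stacking history from the edges, and counting\<close>

lemma stack_edges_inject:
  assumes "stack_edges v F E = stack_edges v F' E'"
    and "\<And>e. e \<in> E \<Longrightarrow> v \<notin> e" "\<And>e. e \<in> E' \<Longrightarrow> v \<notin> e" "v \<notin> F" "v \<notin> F'"
  shows "E = E' \<and> F = F'"
proof -
  \<comment> \<open>The edges avoiding the last label are the old ones, and the neighbours of that
    label are the corners of the face used.\<close>
  have "E = {e \<in> stack_edges v F E. v \<notin> e}" "E' = {e \<in> stack_edges v F' E'. v \<notin> e}"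
    using assms(2,3) unfolding stack_edges_def by auto
  moreover have "F = {x. {v, x} \<in> stack_edges v F E}" "F' = {x. {v, x} \<in> stack_edges v F' E'}"
    using assms(2-5) unfolding stack_edges_def by (auto simp: doubleton_eq_iff)
  ultimately show ?thesis using assms(1) by metis
qed

lemma stacked_stack_edges_inject:
  assumes "stacked m E \<Phi>" "stacked m E' \<Phi>'" "F \<in> \<Phi>" "F' \<in> \<Phi>'"
    and "stack_edges (Suc m) F E = stack_edges (Suc m) F' E'"
  shows "E = E' \<and> F = F'"
proof (rule stack_edges_inject[OF assms(5)])
  have "F \<in> triangles_of {1..m} E" "F' \<in> triangles_of {1..m} E'"
    using stacked_faces_triangles[OF assms(1)] stacked_faces_triangles[OF assms(2)] assms(3,4) by auto
  from triangles_ofD(1)[OF this(1)] triangles_ofD(1)[OF this(2)]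
  show "Suc m \<notin> F" "Suc m \<notin> F'" by auto
  show "Suc m \<notin> e" if "e \<in> E" for e using stacked_edges[OF assms(1) that] by auto
  show "Suc m \<notin> e" if "e \<in> E'" for e using stacked_edges[OF assms(2) that] by auto
qed

lemma stacked_SucE:
  assumes "stacked (Suc m) E \<Phi>" "m \<ge> 4"
  obtains E' \<Phi>' F where "stacked m E' \<Phi>'" "F \<in> \<Phi>'"
    "E = stack_edges (Suc m) F E'" "\<Phi> = stack_faces (Suc m) F \<Phi>'"
  using assms by (auto elim: stacked.cases)

text \<open>The faces are not simply the 3-cycles, because a triangle that was stacked into remains
  a 3-cycle. Instead the last label reveals the previous edges and the face used, and induction
  gives the faces. Thus triangulations may be counted as edge sets.\<close>

lemma stacked_faces_unique: "stacked m E \<Phi> \<Longrightarrow> stacked m E \<Phi>' \<Longrightarrow> \<Phi> = \<Phi>'"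
proof (induction arbitrary: \<Phi>' rule: stacked.induct)
  case base
  from base show ?case by (rule stacked.cases) (auto dest: stacked_ge_4)
next
  case (step m E \<Phi> F)
  from stacked_SucE[OF step.prems stacked_ge_4[OF step.hyps(1)]] obtain E' \<Phi>'' F'
    where *: "stacked m E' \<Phi>''" "F' \<in> \<Phi>''"
    "stack_edges (Suc m) F E = stack_edges (Suc m) F' E'" "\<Phi>' = stack_faces (Suc m) F' \<Phi>''" .
  have "E = E' \<and> F = F'"
    by (rule stacked_stack_edges_inject[OF step.hyps(1) *(1) step.hyps(2) *(2,3)])
  then show ?case using step.IH[of \<Phi>''] * by simp
qed

definition stackings :: "nat \<Rightarrow> nat set set set" where
  "stackings n = {E. \<exists>\<Phi>. stacked n E \<Phi>}"

lemma stackings_4: "stackings 4 = {{e. e \<subseteq> {1..4} \<and> card e = 2}}"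
proof -
  have "E = {e. e \<subseteq> {1..4} \<and> card e = 2}" if "stacked 4 E \<Phi>" for E \<Phi>
    using that by (rule stacked.cases) (auto dest: stacked_ge_4)
  then show ?thesis unfolding stackings_def using stacked.base by blast
qed

lemma finite_stackings: "finite (stackings n)"
proof (rule finite_subset)
  show "stackings n \<subseteq> Pow (Pow {1..n})"
    unfolding stackings_def using stacked_edges by blast
qed simp

lemma card_stackings_Suc:
  assumes "m \<ge> 4"
  shows "card (stackings (Suc m)) = card (stackings m) * (2 * m - 4)"
proof -
  \<comment> \<open>Well defined by uniqueness of the faces; stackings of the next size then
    correspond to pairs of a stacking and one of its faces.\<close>
  define faces where "faces E = (THE \<Phi>. stacked m E \<Phi>)" for E
  have faces: "faces E = \<Phi>" if "stacked m E \<Phi>" for E \<Phi>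
    unfolding faces_def by (rule the_equality) (use that stacked_faces_unique in auto)
  have st: "stacked m E (faces E)" if "E \<in> stackings m" for E
    using that faces unfolding stackings_def by auto
  have "stackings (Suc m) = (\<lambda>(E, F). stack_edges (Suc m) F E) ` Sigma (stackings m) faces"
  proof (intro equalityI subsetI)
    fix E assume "E \<in> stackings (Suc m)"
    then obtain \<Phi> where "stacked (Suc m) E \<Phi>" unfolding stackings_def by blast
    from stacked_SucE[OF this assms] obtain E' \<Phi>' F where
      *: "stacked m E' \<Phi>'" "F \<in> \<Phi>'" "E = stack_edges (Suc m) F E'" .
    then have "(E', F) \<in> Sigma (stackings m) faces"
      using faces[OF *(1)] unfolding stackings_def by blast
    then show "E \<in> (\<lambda>(E, F). stack_edges (Suc m) F E) ` Sigma (stackings m) faces"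
      using *(3) by (intro image_eqI[of _ _ "(E', F)"]) auto
  next
    fix E assume "E \<in> (\<lambda>(E, F). stack_edges (Suc m) F E) ` Sigma (stackings m) faces"
    then obtain E' F where "E' \<in> stackings m" "F \<in> faces E'" "E = stack_edges (Suc m) F E'" by auto
    then show "E \<in> stackings (Suc m)"
      using stacked.step[OF st] unfolding stackings_def by blast
  qed
  moreover have "inj_on (\<lambda>(E, F). stack_edges (Suc m) F E) (Sigma (stackings m) faces)"
    using stacked_stack_edges_inject[OF st st] by (auto simp: inj_on_def)
  ultimately have "card (stackings (Suc m)) = card (Sigma (stackings m) faces)"
    by (simp add: card_image)
  also have "\<dots> = (\<Sum>E\<in>stackings m. card (faces E))"
    using stacked_card_faces[OF st] finite_stackings by (intro card_SigmaI) auto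
  also have "\<dots> = (\<Sum>E\<in>stackings m. 2 * m - 4)"
    using stacked_card_faces[OF st] by (intro sum.cong) auto
  finally show ?thesis by simp
qed

text \<open>Label m + 1 has 2 (m - 2) choices. For m from 4 to n - 1 these multiply to 2^(n-4) times
  the product of 2, 3, ..., n - 3.\<close>

lemma card_stackings:
  assumes "n \<ge> 4"
  shows "card (stackings n) = 2 ^ (n - 4) * fact (n - 3)"
  using assms
proof (induction n rule: dec_induct)
  case base
  show ?case by (simp add: stackings_4)
next
  case (step m)
  obtain k where m: "m = k + 4" using step.hyps(1) le_Suc_ex by (metis add.commute)
  have IH: "card (stackings m) = 2 ^ k * fact (k + 1)" using step.IH m by simp
  have "2 * m - 4 = 2 * (k + 2)" using m by simp
  then have "card (stackings (Suc m)) = 2 ^ k * fact (k + 1) * (2 * (k + 2))"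
    using card_stackings_Suc[OF step.hyps(1)] IH by metis
  also have "\<dots> = 2 ^ Suc k * ((k + 2) * fact (k + 1))" by (simp only: power_Suc mult_ac)
  also have "(k + 2) * fact (k + 1) = (fact (Suc (k + 1)) :: nat)" by (simp add: algebra_simps)
  finally show ?case using m by (simp add: eval_nat_numeral)
qed

section \<open>Reconstruction of a stacked triangulation from a placement\<close>

lemma stacked_encloses:
  "stacked m E \<Phi> \<Longrightarrow> in_general_position p {1..m} \<Longrightarrow> noncrossing p E \<Longrightarrow>
    \<exists>Q. encloses p {1..m} \<Phi> Q"
proof (induction rule: stacked.induct)
  case base
  then show ?case by (intro encloses_four_points) simp_all
next
  case (step m E \<Phi> F)
  have V: "insert (Suc m) {1..m} = {1..Suc m}" by auto
  have "noncrossing p E"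
    using step.prems(2) by (rule noncrossing_mono) (auto simp: stack_edges_def)
  moreover have "in_general_position p {1..m}"
    using step.prems(1) by (rule in_general_position_mono) auto
  ultimately obtain Q where Q: "encloses p {1..m} \<Phi> Q" using step.IH by blast
  have "\<exists>Q'. encloses p (insert (Suc m) {1..m}) (stack_faces (Suc m) F \<Phi>) Q'"
    by (rule encloses_stack[OF _ step.prems(2) stacked_faces_triangles[OF step.hyps(1)] _ Q step.hyps(2)])
      (use step.prems(1) V in auto)
  then show ?case unfolding V .
qed

lemma stacked_unique:
  "stacked m E \<Phi> \<Longrightarrow> stacked m E' \<Phi>' \<Longrightarrow> in_general_position p {1..m} \<Longrightarrow>
    noncrossing p E \<Longrightarrow> noncrossing p E' \<Longrightarrow> E = E'"
proof (induction arbitrary: E' \<Phi>' rule: stacked.induct)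
  case base
  from base(1) show ?case by (rule stacked.cases) (auto dest: stacked_ge_4)
next
  case (step m E \<Phi> F)
  from stacked_SucE[OF step.prems(1) stacked_ge_4[OF step.hyps(1)]] obtain D \<Psi> F'
    where *: "stacked m D \<Psi>" "F' \<in> \<Psi>" "E' = stack_edges (Suc m) F' D" by metis
  have nc: "noncrossing p E" "noncrossing p D"
    using noncrossing_mono[OF step.prems(3), of E] noncrossing_mono[OF step.prems(4), of D] *(3)
    by (auto simp: stack_edges_def)
  have gp: "in_general_position p {1..m}"
    using step.prems(2) by (rule in_general_position_mono) auto
  \<comment> \<open>The induction hypothesis equates edge sets only; the face sets agree because
    edges determine them, so the last label is located among the same faces in both
    histories.\<close>
  have DE: "D = E" using step.IH[OF *(1) gp nc] by simp
  then have \<Psi>: "\<Psi> = \<Phi>" using stacked_faces_unique[OF step.hyps(1)] *(1) by simp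
  obtain Q where Q: "encloses p {1..m} \<Phi> Q"
    using stacked_encloses[OF step.hyps(1) gp nc(1)] by blast
  have "F = F'"
    by (rule stacking_face_unique[OF gp _ _ stacked_faces_triangles[OF step.hyps(1)] _ Q])
      (use step.prems(3,4) step.hyps(2) *(2,3) DE \<Psi> in auto)
  then show ?case using * DE by simp
qed

section \<open>Orientations and perturbation\<close>

text \<open>Twice the signed area of the triangle: the determinant in \<open>orientation\<close>
  after \<open>a\<close> has been translated to the origin.\<close>

definition turn :: "plane \<Rightarrow> plane \<Rightarrow> plane \<Rightarrow> real" where
  "turn a b c = (b $ 1 - a $ 1) * (c $ 2 - a $ 2) - (b $ 2 - a $ 2) * (c $ 1 - a $ 1)"

lemma orientation_eq_sgn_turn: "orientation a b c = sgn (turn a b c)"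
  unfolding orientation_def turn_def by (simp add: det_3 vector_3 algebra_simps)

lemma collinear_iff_turn_eq_0: "collinear {a, b, c} \<longleftrightarrow> turn a b c = 0"
proof -
  define x y where "x = a - b" and "y = c - b"
  have "collinear {a, b, c} \<longleftrightarrow> collinear {0, x, y}"
    unfolding x_def y_def by (rule collinear_3) (simp add: NO_MATCH_def)
  also have "\<dots> \<longleftrightarrow> x = 0 \<or> y = 0 \<or> (\<exists>k. y = k *\<^sub>R x)" by (rule collinear_lemma)
  also have "\<dots> \<longleftrightarrow> x $ 1 * y $ 2 = x $ 2 * y $ 1"
  proof
    assume "x $ 1 * y $ 2 = x $ 2 * y $ 1"
    then have "y = (y $ 1 / x $ 1) *\<^sub>R x" if "x $ 1 \<noteq> 0"
      using that by (simp add: vec_eq_iff forall_2 field_simps)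
    moreover have "y = (y $ 2 / x $ 2) *\<^sub>R x" if "x $ 2 \<noteq> 0"
      using that \<open>x $ 1 * y $ 2 = x $ 2 * y $ 1\<close> by (simp add: vec_eq_iff forall_2 field_simps)
    moreover have "x = 0" if "x $ 1 = 0" "x $ 2 = 0"
      using that by (simp add: vec_eq_iff forall_2)
    ultimately show "x = 0 \<or> y = 0 \<or> (\<exists>k. y = k *\<^sub>R x)" by blast
  qed auto
  also have "\<dots> \<longleftrightarrow> turn a b c = 0"
    unfolding x_def y_def turn_def by (auto simp: algebra_simps)
  finally show ?thesis .
qed

lemma turn_affine:
  "turn a b ((1 - u) *\<^sub>R c + u *\<^sub>R d) = (1 - u) * turn a b c + u * turn a b d"
  unfolding turn_def by (simp add: algebra_simps)

lemma turn_degenerate [simp]: "turn a b a = 0" "turn a b b = 0"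
  unfolding turn_def by (simp_all add: algebra_simps)

text \<open>\<open>turn a b\<close> vanishes at the common point and is affine along the segment
  from \<open>c\<close> to \<open>d\<close>; a convex combination of two nonzero numbers of equal
  sign is never 0.\<close>

lemma sgn_turn_differ:
  assumes "w \<in> closed_segment a b" "w \<in> closed_segment c d" "turn a b c \<noteq> 0" "turn a b d \<noteq> 0"
  shows "sgn (turn a b c) \<noteq> sgn (turn a b d)"
proof
  assume eq: "sgn (turn a b c) = sgn (turn a b d)"
  obtain s where "w = (1 - s) *\<^sub>R a + s *\<^sub>R b"
    using assms(1) by (auto simp: in_segment)
  then have 0: "turn a b w = 0" by (simp add: turn_affine)
  obtain u where u: "0 \<le> u" "u \<le> 1" "w = (1 - u) *\<^sub>R c + u *\<^sub>R d"
    using assms(2) by (auto simp: in_segment)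
  have sum0: "(1 - u) * turn a b c + u * turn a b d = 0" using 0 u(3) turn_affine by simp
  have pos: "(1 - u) * r + u * s > 0" if "r > 0" "s > 0" for r s :: real
    using that u by (cases "u = 0") (auto intro: add_nonneg_pos)
  show False
  proof (cases "turn a b c > 0")
    case True
    then have "turn a b d > 0" using eq assms(4) by (auto simp: sgn_if split: if_splits)
    then show False using pos[of "turn a b c" "turn a b d"] True sum0 by simp
  next
    case False
    then have c: "turn a b c < 0" using assms(3) by simp
    then have "turn a b d < 0" using eq assms(4) by (auto simp: sgn_if split: if_splits)
    then show False using pos[of "- turn a b c" "- turn a b d"] c sum0 by simp
  qed
qed

text \<open>Four orientations decide whether two segments meet, which makes
  \<open>noncrossing\<close> an invariant of the order type. For the converse,
  \<open>turn a b\<close> and \<open>turn c d\<close> each change sign along the other segment, and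
  their zeros turn out to be the same point.\<close>

lemma segments_meet_iff:
  assumes "turn a b c \<noteq> 0" "turn a b d \<noteq> 0" "turn c d a \<noteq> 0" "turn c d b \<noteq> 0"
  shows "closed_segment a b \<inter> closed_segment c d \<noteq> {} \<longleftrightarrow>
    sgn (turn a b c) \<noteq> sgn (turn a b d) \<and> sgn (turn c d a) \<noteq> sgn (turn c d b)"
proof
  assume "closed_segment a b \<inter> closed_segment c d \<noteq> {}"
  then show "sgn (turn a b c) \<noteq> sgn (turn a b d) \<and> sgn (turn c d a) \<noteq> sgn (turn c d b)"
    using sgn_turn_differ assms by blast
next
  assume sg: "sgn (turn a b c) \<noteq> sgn (turn a b d) \<and> sgn (turn c d a) \<noteq> sgn (turn c d b)"
  define A B C D where "A = turn a b c" and "B = turn a b d" and "C = turn c d a" and "D = turn c d b"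
  \<comment> \<open>\<open>s / (s - r)\<close> is the parameter at which an affine function with end
    values \<open>s\<close> and \<open>r\<close> vanishes.\<close>
  have quot: "0 \<le> s / (s - r) \<and> s / (s - r) \<le> 1" if "sgn s \<noteq> sgn r" "s \<noteq> 0" "r \<noteq> 0" for s r :: real
    using that by (auto simp: sgn_if divide_simps split: if_splits)
  have AB: "A \<noteq> B" "C \<noteq> D" using sg unfolding A_def B_def C_def D_def by auto
  \<comment> \<open>Up to sign, \<open>A - B\<close> and \<open>C - D\<close> are both the cross
    product of \<open>b - a\<close> and \<open>d - c\<close>; dividing by it is Cramer's rule for
    the intersection of the two lines.\<close>
  define K where "K = C - D"
  have K: "A - B = - K" "K \<noteq> 0"
    using AB unfolding K_def A_def B_def C_def D_def turn_def by (auto simp: algebra_simps)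
  have "K *\<^sub>R c - A *\<^sub>R (d - c) = K *\<^sub>R a + C *\<^sub>R (b - a)"
    unfolding K_def A_def C_def D_def turn_def vec_eq_iff forall_2 by (simp add: algebra_simps)
  then have "(1 / K) *\<^sub>R (K *\<^sub>R c - A *\<^sub>R (d - c)) = (1 / K) *\<^sub>R (K *\<^sub>R a + C *\<^sub>R (b - a))" by simp
  then have line: "c - (A / K) *\<^sub>R (d - c) = a + (C / K) *\<^sub>R (b - a)"
    using K(2) by (simp add: scaleR_right_distrib scaleR_right_diff_distrib)
  have "A / (A - B) = - (A / K)" unfolding K(1) by simp
  moreover have "C / (C - D) = C / K" unfolding K_def ..
  moreover have "(1 - - (A / K)) *\<^sub>R c + (- (A / K)) *\<^sub>R d = (1 - C / K) *\<^sub>R a + (C / K) *\<^sub>R b"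
    using line by (simp add: algebra_simps)
  ultimately have "(1 - A / (A - B)) *\<^sub>R c + (A / (A - B)) *\<^sub>R d =
      (1 - C / (C - D)) *\<^sub>R a + (C / (C - D)) *\<^sub>R b"
    by (simp only:)
  moreover have "(1 - A / (A - B)) *\<^sub>R c + (A / (A - B)) *\<^sub>R d \<in> closed_segment c d"
    using quot[of A B] sg assms unfolding A_def B_def in_segment by blast
  moreover have "(1 - C / (C - D)) *\<^sub>R a + (C / (C - D)) *\<^sub>R b \<in> closed_segment a b"
    using quot[of C D] sg assms unfolding C_def D_def in_segment by blast
  ultimately show "closed_segment a b \<inter> closed_segment c d \<noteq> {}" by (metis disjoint_iff)
qed

lemma general_position_turn:
  assumes "in_general_position p V" "{x, y, z} \<subseteq> V" "x \<noteq> y" "x \<noteq> z" "y \<noteq> z"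
  shows "turn (p x) (p y) (p z) \<noteq> 0"
  using general_position_not_collinear[OF assms] collinear_iff_turn_eq_0 by blast

lemma noncrossing_isomorphic:
  assumes gp: "in_general_position p V" "in_general_position q V"
    and E: "\<And>e. e \<in> E \<Longrightarrow> e \<subseteq> V \<and> card e = 2"
    and iso: "\<And>i j k. i \<in> V \<Longrightarrow> j \<in> V \<Longrightarrow> k \<in> V \<Longrightarrow>
      orientation (p i) (p j) (p k) = orientation (q i) (q j) (q k)"
    and nc: "noncrossing p E"
  shows "noncrossing q E"
  unfolding noncrossing_def
proof (intro ballI impI)
  fix e f assume ef: "e \<in> E" "f \<in> E" "e \<inter> f = {}"
  obtain x y where e: "e = {x, y}" "x \<noteq> y" using E[OF ef(1)] by (auto simp: card_2_iff)
  obtain z w where f: "f = {z, w}" "z \<noteq> w" using E[OF ef(2)] by (auto simp: card_2_iff)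
  have V: "x \<in> V" "y \<in> V" "z \<in> V" "w \<in> V" using E ef e f by auto
  have ne: "x \<noteq> z" "x \<noteq> w" "y \<noteq> z" "y \<noteq> w" using ef(3) e f by auto
  have meet: "closed_segment (r x) (r y) \<inter> closed_segment (r z) (r w) \<noteq> {} \<longleftrightarrow>
      sgn (turn (r x) (r y) (r z)) \<noteq> sgn (turn (r x) (r y) (r w)) \<and>
      sgn (turn (r z) (r w) (r x)) \<noteq> sgn (turn (r z) (r w) (r y))"
    if "in_general_position r V" for r
    by (rule segments_meet_iff; rule general_position_turn[OF that]) (use V ne e f in auto)
  have "closed_segment (p x) (p y) \<inter> closed_segment (p z) (p w) = {}"
    using noncrossingD[OF nc ef] e f by (simp add: segment_convex_hull)
  then have "closed_segment (q x) (q y) \<inter> closed_segment (q z) (q w) = {}"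
    using meet[OF gp(1)] meet[OF gp(2)] iso V unfolding orientation_eq_sgn_turn by metis
  then show "convex hull (q ` e) \<inter> convex hull (q ` f) = {}"
    using e f by (simp add: segment_convex_hull)
qed

section \<open>Stability of disjointness and perturbation into general position\<close>

lemma eventually_segments_disjoint:
  fixes a b c d :: "'b \<Rightarrow> 'a::euclidean_space"
  assumes lim: "(a \<longlongrightarrow> a0) F" "(b \<longlongrightarrow> b0) F" "(c \<longlongrightarrow> c0) F" "(d \<longlongrightarrow> d0) F"
    and disj: "closed_segment a0 b0 \<inter> closed_segment c0 d0 = {}"
  shows "\<forall>\<^sub>F t in F. closed_segment (a t) (b t) \<inter> closed_segment (c t) (d t) = {}"
proof -
  \<comment> \<open>Disjoint compact segments have a positive distance \<open>r\<close>. Moving the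
    endpoints by less than \<open>r / 2\<close> moves each point of a segment by less than
    \<open>r / 2\<close>, so the segments cannot touch.\<close>
  obtain r where r: "r > 0" "\<And>x y. x \<in> closed_segment a0 b0 \<Longrightarrow> y \<in> closed_segment c0 d0 \<Longrightarrow> r \<le> dist x y"
    using separate_compact_closed[of "closed_segment a0 b0" "closed_segment c0 d0"] disj by auto
  have close: "\<exists>x0\<in>closed_segment u0 v0. dist x x0 < r / 2"
    if uv: "dist u u0 < r / 2" "dist v v0 < r / 2" "x \<in> closed_segment u v" for u v u0 v0 x :: 'a
  proof -
    obtain s where s: "0 \<le> s" "s \<le> 1" "x = (1 - s) *\<^sub>R u + s *\<^sub>R v"
      using uv(3) by (auto simp: in_segment)
    define x0 where "x0 = (1 - s) *\<^sub>R u0 + s *\<^sub>R v0"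
    have "x - x0 = (1 - s) *\<^sub>R (u - u0) + s *\<^sub>R (v - v0)"
      unfolding s(3) x0_def by (simp add: algebra_simps)
    then have "dist x x0 \<le> norm ((1 - s) *\<^sub>R (u - u0)) + norm (s *\<^sub>R (v - v0))"
      unfolding dist_norm by (metis norm_triangle_ineq)
    also have "\<dots> = (1 - s) * dist u u0 + s * dist v v0"
      using s by (simp add: dist_norm)
    also have "\<dots> < r / 2"
      by (rule convex_bound_lt) (use uv s in auto)
    finally have "dist x x0 < r / 2" .
    moreover have "x0 \<in> closed_segment u0 v0" unfolding x0_def using s by (auto simp: in_segment)
    ultimately show ?thesis by blast
  qed
  have ev: "\<forall>\<^sub>F t in F. dist (a t) a0 < r / 2" "\<forall>\<^sub>F t in F. dist (b t) b0 < r / 2"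
    "\<forall>\<^sub>F t in F. dist (c t) c0 < r / 2" "\<forall>\<^sub>F t in F. dist (d t) d0 < r / 2"
    using lim[THEN tendstoD, of "r / 2"] r(1) by simp_all
  show ?thesis
    using ev
  proof eventually_elim
    case (elim t)
    show ?case
    proof (rule ccontr)
      assume "\<not> ?thesis"
      then obtain x where x: "x \<in> closed_segment (a t) (b t)" "x \<in> closed_segment (c t) (d t)" by blast
      obtain y where y: "y \<in> closed_segment a0 b0" "dist x y < r / 2"
        using close[OF elim(1,2) x(1)] by blast
      obtain z where z: "z \<in> closed_segment c0 d0" "dist x z < r / 2"
        using close[OF elim(3,4) x(2)] by blast
      show False using r(2)[OF y(1) z(1)] y(2) z(2) dist_triangle_half_r[of x y r z] by (simp add: dist_commute)
    qed
  qed
qed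

lemma eventually_noncrossing:
  assumes "finite E" and E: "\<And>e. e \<in> E \<Longrightarrow> e \<subseteq> V \<and> card e = 2"
    and lim: "\<And>i. i \<in> V \<Longrightarrow> ((\<lambda>t. p t i) \<longlongrightarrow> q i) F" and nc: "noncrossing q E"
  shows "\<forall>\<^sub>F t in F. noncrossing (p t) E"
  unfolding noncrossing_def
proof (intro eventually_ball_finite ballI \<open>finite E\<close>)
  fix e f assume ef: "e \<in> E" "f \<in> E"
  obtain x y where e: "e = {x, y}" using E[OF ef(1)] by (auto simp: card_2_iff)
  obtain z w where f: "f = {z, w}" using E[OF ef(2)] by (auto simp: card_2_iff)
  have V: "x \<in> V" "y \<in> V" "z \<in> V" "w \<in> V" using E ef e f by auto
  show "\<forall>\<^sub>F t in F. e \<inter> f = {} \<longrightarrow> convex hull (p t ` e) \<inter> convex hull (p t ` f) = {}"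
  proof (cases "e \<inter> f = {}")
    case True
    then have "closed_segment (q x) (q y) \<inter> closed_segment (q z) (q w) = {}"
      using noncrossingD[OF nc ef True] e f by (simp add: segment_convex_hull)
    from eventually_segments_disjoint[OF lim[OF V(1)] lim[OF V(2)] lim[OF V(3)] lim[OF V(4)] this]
    show ?thesis by eventually_elim (simp add: e f segment_convex_hull)
  qed simp
qed

lemma eventually_quadratic_nonzero:
  fixes A B C :: real
  assumes "C \<noteq> 0"
  shows "\<forall>\<^sub>F t in at 0. A + B * t + C * t\<^sup>2 \<noteq> 0"
proof -
  have "finite {t. poly [:A, B, C:] t = 0}"
    by (rule poly_roots_finite) (use assms in simp)
  then have "finite {t. A + B * t + C * t\<^sup>2 = 0}"
    by (simp add: algebra_simps power2_eq_square)
  \<comment> \<open>The neighbourhood has to contain 0, so 0 is taken out of the exceptional set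
    even if it is a root; \<open>at 0\<close> ignores the value there.\<close>
  then have "open (- ({t. A + B * t + C * t\<^sup>2 = 0} - {0}))"
    by (intro open_Compl finite_imp_closed finite_Diff)
  then show ?thesis
    unfolding eventually_at_topological
    by (intro exI[of _ "- ({t. A + B * t + C * t\<^sup>2 = 0} - {0})"]) simp
qed

text \<open>Each label moves in the direction of its own point on the parabola, which has no three
  collinear points; a single parameter moves all positions at once.\<close>

definition perturb :: "(nat \<Rightarrow> plane) \<Rightarrow> real \<Rightarrow> nat \<Rightarrow> plane" where
  "perturb p t i = p i + t *\<^sub>R vector [real i, (real i)\<^sup>2]"

text \<open>The quadratic coefficient of the determinant of three perturbed points is the Vandermonde
  determinant of their indices.\<close>

lemma eventually_perturb_general_position:
  assumes "finite V"
  shows "\<forall>\<^sub>F t in at 0. in_general_position (perturb p t) V"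
proof -
  have "\<forall>\<^sub>F t in at 0. card T = 3 \<longrightarrow> \<not> collinear (perturb p t ` T)" for T
  proof (cases "card T = 3")
    case True
    then obtain i j k where T: "T = {i, j, k}" "i \<noteq> j" "i \<noteq> k" "j \<noteq> k" by (auto simp: card_3_iff)
    define A where "A = turn (p i) (p j) (p k)"
    define B where "B = (p j $ 1 - p i $ 1) * ((real k)\<^sup>2 - (real i)\<^sup>2) + (real j - real i) * (p k $ 2 - p i $ 2)
       - (p j $ 2 - p i $ 2) * (real k - real i) - ((real j)\<^sup>2 - (real i)\<^sup>2) * (p k $ 1 - p i $ 1)"
    define C where "C = (real j - real i) * (real k - real i) * (real k - real j)"
    have "turn (perturb p t i) (perturb p t j) (perturb p t k) = A + B * t + C * t\<^sup>2" for t
      unfolding A_def B_def C_def turn_def perturb_def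
      by (simp add: algebra_simps power2_eq_square)
    moreover have "C \<noteq> 0" using T unfolding C_def by simp
    from eventually_quadratic_nonzero[OF this, of A B]
    have "\<forall>\<^sub>F t in at 0. A + B * t + C * t\<^sup>2 \<noteq> 0" .
    ultimately have "\<forall>\<^sub>F t in at 0. turn (perturb p t i) (perturb p t j) (perturb p t k) \<noteq> 0" by simp
    then show ?thesis
      by eventually_elim (simp add: T collinear_iff_turn_eq_0)
  qed simp
  then have "\<forall>\<^sub>F t in at 0. \<forall>T\<in>Pow V. card T = 3 \<longrightarrow> \<not> collinear (perturb p t ` T)"
    using assms by (intro eventually_ball_finite) auto
  then show ?thesis unfolding in_general_position_def by eventually_elim blast
qed

text \<open>The embeddings use the same points, permuted by \<open>\<sigma> i\<close>, so one
  perturbation of the points has to suit all of them. Finitely many properties that hold for all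
  small nonzero \<open>t\<close> have a common \<open>t\<close>.\<close>

lemma noncrossing_perturb:
  fixes p :: "nat \<Rightarrow> plane"
  assumes V: "finite V" and I: "finite I"
    and E: "\<And>i e. i \<in> I \<Longrightarrow> e \<in> E i \<Longrightarrow> e \<subseteq> V \<and> card e = 2"
    and \<sigma>: "\<And>i. i \<in> I \<Longrightarrow> \<sigma> i ` V \<subseteq> V" and nc: "\<And>i. i \<in> I \<Longrightarrow> noncrossing (p \<circ> \<sigma> i) (E i)"
  obtains q where "in_general_position q V" "\<And>i. i \<in> I \<Longrightarrow> noncrossing (q \<circ> \<sigma> i) (E i)"
proof -
  have lim: "((\<lambda>t. perturb p t i) \<longlongrightarrow> p i) (at 0)" for i
    unfolding perturb_def by (auto intro!: tendsto_eq_intros)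
  have "\<forall>\<^sub>F t in at 0. noncrossing (perturb p t \<circ> \<sigma> i) (E i)" if "i \<in> I" for i
  proof (rule eventually_noncrossing[OF _ E[OF that] _ nc[OF that]])
    have "E i \<subseteq> Pow V" using E[OF that] by blast
    then show "finite (E i)" using V finite_subset by blast
    show "((\<lambda>t. (perturb p t \<circ> \<sigma> i) j) \<longlongrightarrow> (p \<circ> \<sigma> i) j) (at 0)" for j
      using lim by simp
  qed
  then have "\<forall>\<^sub>F t in at 0. \<forall>i\<in>I. noncrossing (perturb p t \<circ> \<sigma> i) (E i)"
    by (intro eventually_ball_finite I ballI)
  with eventually_perturb_general_position[OF V, of p]
  have "\<forall>\<^sub>F t in at 0. in_general_position (perturb p t) V \<and>
      (\<forall>i\<in>I. noncrossing (perturb p t \<circ> \<sigma> i) (E i))"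
    by eventually_elim blast
  from eventually_happens[OF this] obtain t where "in_general_position (perturb p t) V"
    "\<forall>i\<in>I. noncrossing (perturb p t \<circ> \<sigma> i) (E i)" by auto
  then show ?thesis using that by blast
qed

section \<open>Drawing stacked triangulations\<close>

lemma noncrossing_stack_edges:
  assumes nc: "noncrossing p E" and E: "\<And>e. e \<in> E \<Longrightarrow> e \<subseteq> V" and v: "v \<notin> V" and N: "N \<subseteq> V"
    and star: "\<And>x e. x \<in> N \<Longrightarrow> e \<in> E \<Longrightarrow> x \<notin> e \<Longrightarrow>
      closed_segment w (p x) \<inter> convex hull (p ` e) = {}"
  shows "noncrossing (p(v := w)) (stack_edges v N E)"
proof -
  let ?q = "p(v := w)"
  have old: "?q ` e = p ` e" if "e \<in> E" for e
    using E[OF that] v by (intro image_cong) auto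
  have new: "convex hull (?q ` {v, x}) = closed_segment w (p x)" if "x \<in> N" for x
  proof -
    have "?q ` {v, x} = {w, p x}" using that N v by auto
    then show ?thesis by (simp only: segment_convex_hull)
  qed
  have disj: "convex hull (?q ` {v, x}) \<inter> convex hull (?q ` e) = {}"
    if "x \<in> N" "e \<in> E" "x \<notin> e" for x e
    unfolding old[OF that(2)] new[OF that(1)] by (rule star[OF that])
  show ?thesis
    unfolding noncrossing_def
  proof (intro ballI impI)
    fix e f assume ef: "e \<in> stack_edges v N E" "f \<in> stack_edges v N E" "e \<inter> f = {}"
    have "e \<in> E \<or> (\<exists>x\<in>N. e = {v, x})" "f \<in> E \<or> (\<exists>x\<in>N. f = {v, x})"
      using ef(1,2) unfolding stack_edges_def by auto
    moreover have "\<not> ((\<exists>x\<in>N. e = {v, x}) \<and> (\<exists>x\<in>N. f = {v, x}))" using ef(3) by auto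
    ultimately consider "e \<in> E" "f \<in> E" | x where "x \<in> N" "e = {v, x}" "f \<in> E"
      | x where "x \<in> N" "f = {v, x}" "e \<in> E" by blast
    then show "convex hull (?q ` e) \<inter> convex hull (?q ` f) = {}"
    proof cases
      case 1
      then show ?thesis using noncrossingD[OF nc _ _ ef(3)] old by simp
    next
      case (2 x)
      then show ?thesis using disj[of x f] ef(3) by auto
    next
      case (3 x)
      then have "convex hull (?q ` f) \<inter> convex hull (?q ` e) = {}"
        using disj[of x e] ef(3) by auto
      then show ?thesis by (simp only: Int_commute)
    qed
  qed
qed

lemma frontier_side_of_triangle:
  assumes "in_general_position p V" "F \<subseteq> V" "card F = 3" "x \<in> F"
  shows "convex hull (p ` (F - {x})) \<subseteq> frontier (convex hull (p ` F))"
proof -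
  have inj: "inj_on p F"
    using general_position_inj_on[OF in_general_position_mono[OF assms(1,2)]] assms(3) by simp
  then have "card (p ` F) = 3" using assms(3) by (simp add: card_image)
  then have fr: "frontier (convex hull (p ` F)) = \<Union> {convex hull (p ` F - {a}) | a. a \<in> p ` F}"
    by (intro frontier_of_convex_hull) simp
  have "p ` (F - {x}) = p ` F - {p x}" using inj assms(4) by (auto simp: inj_on_def)
  then show ?thesis unfolding fr using assms(4) by auto
qed

text \<open>From an interior point \<open>u\<close> of the triangle, the edge towards the outer end
  \<open>y\<close> leaves through a side. That side contains \<open>z\<close>, the only vertex it
  can share with the edge, and by general position the exit point is \<open>p z\<close>. So
  \<open>p z\<close> lies between \<open>u\<close> and \<open>p y\<close> while \<open>u\<close>
  lies between \<open>p y\<close> and \<open>p z\<close>; hence \<open>u\<close> is a corner and not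
  interior.\<close>

lemma edge_avoids_inner_face_aux:
  assumes gp: "in_general_position p V" and nc: "noncrossing p E"
    and \<Phi>: "\<Phi> \<subseteq> triangles_of V E" and enc: "encloses p V \<Phi> Q" and F: "F \<in> \<Phi>" "F \<noteq> Q"
    and e: "{y, z} \<in> E" "y \<in> V" "z \<in> V" "y \<noteq> z" and y: "y \<notin> F"
  shows "closed_segment (p y) (p z) \<inter> interior (convex hull (p ` F)) = {}"
proof (rule ccontr)
  assume "\<not> ?thesis"
  then obtain u where u: "u \<in> closed_segment (p y) (p z)" "u \<in> interior (convex hull (p ` F))" by blast
  have "F \<in> triangles_of V E" using F \<Phi> by blast
  note FD = triangles_ofD[OF this]
  have uF: "u \<in> convex hull (p ` F)" using u(2) interior_subset by blast
  have "p y \<notin> convex hull (p ` F)" using enclosesD(4)[OF enc F e(2)] y by blast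
  from general_position_segment_meets_side[OF gp FD(1,2) uF this] obtain x where
    x: "x \<in> F" "closed_segment u (p y) \<inter> convex hull (p ` (F - {x})) \<noteq> {}" .
  then obtain s where s: "s \<in> closed_segment u (p y)" "s \<in> convex hull (p ` (F - {x}))" by blast
  have "closed_segment u (p y) \<subseteq> closed_segment (p y) (p z)"
    using u(1) by (simp add: subset_closed_segment)
  then have syz: "s \<in> closed_segment (p y) (p z)" using s(1) by blast
  have side: "F - {x} \<in> E" using FD(3)[OF x(1)] .
  have z: "z \<in> F - {x}"
  proof (rule ccontr)
    assume "z \<notin> F - {x}"
    then have "{y, z} \<inter> (F - {x}) = {}" using y by blast
    from noncrossingD[OF nc e(1) side this] show False
      using s(2) syz by (auto simp: segment_convex_hull)
  qed
  obtain a b where ab: "F - {x} = {a, b}" "a \<noteq> b" using card3_Diff_pair[OF FD(2) x(1)] by metis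
  obtain z' where z': "F - {x} = {z, z'}" "z' \<noteq> z"
  proof (cases "z = a")
    case True
    then show ?thesis using that[of b] ab by simp
  next
    case False
    then show ?thesis using that[of a] ab z by (simp add: insert_commute)
  qed
  have "z' \<in> F" using z' by blast
  then have "\<not> collinear {p y, p z, p z'}"
    using general_position_not_collinear[OF gp, of y z z'] e y z' FD(1) by auto
  then have "closed_segment (p y) (p z) \<inter> closed_segment (p z) (p z') = {p z}"
    by (intro Int_closed_segment) blast
  moreover have "s \<in> closed_segment (p z) (p z')" using s(2) z' by (simp add: segment_convex_hull)
  ultimately have "s = p z" using syz by blast
  then have "between (p y, u) (p z)" "between (p y, p z) u"
    using s(1) u(1) by (auto simp: between_mem_segment closed_segment_commute)
  then have "u = p z" using between_antisym[of "p z" "p y" u] by (simp add: between_commute)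
  then have "u \<in> convex hull (p ` (F - {x}))" using z by (auto intro: hull_inc)
  then have "u \<in> frontier (convex hull (p ` F))"
    using frontier_side_of_triangle[OF gp FD(1,2) x(1)] by blast
  then show False using u(2) unfolding frontier_def by blast
qed

lemma edge_avoids_inner_face:
  assumes gp: "in_general_position p V" and nc: "noncrossing p E"
    and \<Phi>: "\<Phi> \<subseteq> triangles_of V E" and enc: "encloses p V \<Phi> Q" and F: "F \<in> \<Phi>" "F \<noteq> Q"
    and e: "{y, z} \<in> E" "y \<in> V" "z \<in> V" "y \<noteq> z"
  shows "closed_segment (p y) (p z) \<inter> interior (convex hull (p ` F)) = {}"
proof -
  consider "y \<notin> F" | "z \<notin> F" | "y \<in> F" "z \<in> F" by blast
  then show ?thesis
  proof cases
    case 1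
    then show ?thesis using edge_avoids_inner_face_aux[OF assms] by blast
  next
    case 2
    have "{z, y} \<in> E" using e(1) by (simp add: insert_commute)
    then show ?thesis
      using edge_avoids_inner_face_aux[OF gp nc \<Phi> enc F, of z y] e(2-4) 2
      by (simp add: closed_segment_commute)
  next
    case 3
    have "F \<in> triangles_of V E" using F \<Phi> by blast
    note FD = triangles_ofD[OF this]
    have "card (F - {y, z}) = 1" using FD(2,4) 3 e(4) by (simp add: card_Diff_subset)
    then obtain x where "F - {y, z} = {x}" by (rule card_1_singletonE)
    then have x: "x \<in> F" "F - {x} = {y, z}" using 3 by auto
    have "closed_segment (p y) (p z) \<subseteq> frontier (convex hull (p ` F))"
      using frontier_side_of_triangle[OF gp FD(1,2) x(1)] unfolding x(2)
      by (simp add: segment_convex_hull)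
    then show ?thesis unfolding frontier_def by blast
  qed
qed

text \<open>The starting point has barycentric coordinates 2, -1/2, -1/2, so it lies beyond the
  corner \<open>a\<close>. Every corner has coordinate 0 at \<open>b\<close> or at \<open>c\<close>;
  along the segment that coordinate is negative until the corner is reached, while it is nonnegative
  on the triangle. Thus all three corners are visible.\<close>

lemma outer_point_sees_triangle:
  fixes a b c :: plane
  assumes nc: "\<not> collinear {a, b, c}" and x: "x \<in> {a, b, c}"
    and u: "u \<in> closed_segment (2 *\<^sub>R a - (1 / 2) *\<^sub>R (b + c)) x" "u \<in> convex hull {a, b, c}"
  shows "u = x"
proof -
  define w where "w = 2 *\<^sub>R a - (1 / 2) *\<^sub>R (b + c)"
  obtain t where t: "0 \<le> t" "t \<le> 1" "u = (1 - t) *\<^sub>R w + t *\<^sub>R x"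
    using u(1) unfolding w_def by (auto simp: in_segment)
  obtain r s k where rsk: "0 \<le> r" "0 \<le> s" "0 \<le> k" "r + s + k = 1" "u = r *\<^sub>R a + s *\<^sub>R b + k *\<^sub>R c"
    using u(2) unfolding convex_hull_3 by blast
  define T where "T = turn a b c"
  have T: "T \<noteq> 0" using nc unfolding T_def collinear_iff_turn_eq_0 .
  have r: "r = 1 - s - k" using rsk(4) by simp
  \<comment> \<open>Barycentric coordinates as ratios of areas: \<open>k\<close> belongs to
    \<open>c\<close>, and \<open>s\<close> to \<open>b\<close>.\<close>
  have tu: "turn a b u = k * T" "turn c a u = s * T"
    unfolding rsk(5) r T_def turn_def by (simp_all add: algebra_simps)
  have tw: "turn a b w = - T / 2" "turn c a w = - T / 2"
    unfolding w_def T_def turn_def by (simp_all add: field_simps)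
  have k: "k * T = (1 - t) * (- T / 2) + t * turn a b x"
    and s: "s * T = (1 - t) * (- T / 2) + t * turn c a x"
    using turn_affine[of a b t w x] turn_affine[of c a t w x]
    unfolding t(3)[symmetric] tu tw .
  have "turn a b x = 0 \<or> turn c a x = 0" using x by auto
  then have "k = - (1 - t) / 2 \<or> s = - (1 - t) / 2"
  proof
    assume "turn a b x = 0"
    then have "k * T = (- (1 - t) / 2) * T" using k by (simp add: field_simps)
    then show ?thesis using T by (simp only: mult_cancel_right) simp
  next
    assume "turn c a x = 0"
    then have "s * T = (- (1 - t) / 2) * T" using s by (simp add: field_simps)
    then show ?thesis using T by (simp only: mult_cancel_right) simp
  qed
  then have "t = 1" using rsk(2,3) t(2) by auto
  then show ?thesis using t(3) by simp
qed

text \<open>In an inner face the centroid works, since no edge enters the interior; for the outer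
  face a point beyond a corner sees all three corners. The position found may be collinear with old
  points, which a perturbation repairs afterwards.\<close>

lemma stacking_position:
  assumes gp: "in_general_position p V" and V: "card V \<ge> 3"
    and nc: "noncrossing p E" and E: "\<And>e. e \<in> E \<Longrightarrow> e \<subseteq> V \<and> card e = 2"
    and \<Phi>: "\<Phi> \<subseteq> triangles_of V E" and enc: "encloses p V \<Phi> Q" and F: "F \<in> \<Phi>"
  obtains w where "\<And>x e. x \<in> F \<Longrightarrow> e \<in> E \<Longrightarrow> x \<notin> e \<Longrightarrow>
    closed_segment w (p x) \<inter> convex hull (p ` e) = {}"
proof -
  have "F \<in> triangles_of V E" using F \<Phi> by blast
  note FD = triangles_ofD[OF this]
  obtain a b c where abc: "F = {a, b, c}" "a \<noteq> b" "a \<noteq> c" "b \<noteq> c"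
    using FD(2) by (auto simp: card_3_iff)
  have ncol: "\<not> collinear {p a, p b, p c}"
    using general_position_not_collinear[OF gp, of a b c] abc FD(1) by blast
  have pF: "p ` F = {p a, p b, p c}" using abc(1) by simp
  have off: "p x \<notin> convex hull (p ` e)" if xe: "x \<in> F" "e \<in> E" "x \<notin> e" for x e
  proof
    assume *: "p x \<in> convex hull (p ` e)"
    obtain y z where yz: "e = {y, z}" using E[OF xe(2)] by (auto simp: card_2_iff)
    then have "p x \<in> closed_segment (p y) (p z)" using * by (simp add: segment_convex_hull)
    then have "x = y \<or> x = z"
      using general_position_in_segment[OF gp _ _ V, of y z x] E[OF xe(2)] yz xe FD(1) by blast
    then show False using xe yz by blast
  qed
  show ?thesis
  proof (cases "F = Q")
    case True
    show ?thesis
    proof (rule that)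
      fix x e assume x: "x \<in> F" "e \<in> E" "x \<notin> e"
      have "p ` e \<subseteq> convex hull (p ` F)"
        using E[OF x(2)] enclosesD(2)[OF enc] True by blast
      then have sub: "convex hull (p ` e) \<subseteq> convex hull {p a, p b, p c}"
        unfolding pF by (rule hull_minimal) simp
      have "p x \<in> {p a, p b, p c}" using x(1) abc(1) by auto
      then have "u = p x" if "u \<in> closed_segment (2 *\<^sub>R p a - (1 / 2) *\<^sub>R (p b + p c)) (p x)"
        "u \<in> convex hull (p ` e)" for u
        using outer_point_sees_triangle[OF ncol _ that(1)] that(2) sub by blast
      then show "closed_segment (2 *\<^sub>R p a - (1 / 2) *\<^sub>R (p b + p c)) (p x) \<inter> convex hull (p ` e) = {}"
        using off[OF x] by blast
    qed
  next
    case False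
    define w where "w = (1/3) *\<^sub>R p a + (1/3) *\<^sub>R p b + (1/3) *\<^sub>R p c"
    have "\<exists>x y z. 0 < x \<and> 0 < y \<and> 0 < z \<and> x + y + z = 1 \<and> x *\<^sub>R p a + y *\<^sub>R p b + z *\<^sub>R p c = w"
      by (rule exI[of _ "1/3"], rule exI[of _ "1/3"], rule exI[of _ "1/3"]) (simp add: w_def)
    then have w: "w \<in> interior (convex hull (p ` F))"
      unfolding pF using interior_convex_hull_3_minimal[OF ncol] by simp
    show ?thesis
    proof (rule that)
      fix x e assume x: "x \<in> F" "e \<in> E" "x \<notin> e"
      obtain y z where yz: "e = {y, z}" "y \<noteq> z" using E[OF x(2)] by (auto simp: card_2_iff)
      then have "y \<in> V" "z \<in> V" using E[OF x(2)] by auto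
      then have avoid: "convex hull (p ` e) \<inter> interior (convex hull (p ` F)) = {}"
        using edge_avoids_inner_face[OF gp nc \<Phi> enc F False, of y z] x(2) yz
        by (simp add: segment_convex_hull)
      have "p x \<in> convex hull (p ` F)" using x(1) by (auto intro: hull_inc)
      then have "p x \<in> closure (convex hull (p ` F))" using closure_subset by blast
      then have "open_segment w (p x) \<subseteq> interior (convex hull (p ` F))"
        by (intro in_interior_closure_convex_segment w) simp
      then have "closed_segment w (p x) \<subseteq> insert (p x) (interior (convex hull (p ` F)))"
        using w unfolding closed_segment_eq_open by blast
      then show "closed_segment w (p x) \<inter> convex hull (p ` e) = {}"
        using avoid off[OF x] by blast
    qed
  qed
qed

text \<open>Provides the planarity of the graphs in a conflict collection. General position is
  carried through the induction because the existence of an outer triangle relies on it; it is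
  restored by a perturbation after each new point.\<close>

lemma stacked_realizable:
  "stacked m E \<Phi> \<Longrightarrow> \<exists>p. in_general_position p {1..m} \<and> noncrossing p E"
proof (induction rule: stacked.induct)
  case base
  \<comment> \<open>Label 4 is placed at the centroid of the triangle of the other three.\<close>
  define p :: "nat \<Rightarrow> plane" where
    "p i = (if i = 1 then vector [0, 0] else if i = 2 then vector [3, 0]
       else if i = 3 then vector [0, 3] else vector [1, 1])" for i
  have four: "{1..4} = {1, 2, 3, 4::nat}" by auto
  have turn: "turn (p x) (p y) (p z) \<noteq> 0"
    if "x \<in> {1..4}" "y \<in> {1..4}" "z \<in> {1..4}" "x \<noteq> y" "x \<noteq> z" "y \<noteq> z" for x y z
    using that unfolding four by (elim insertE emptyE) (simp_all add: p_def turn_def)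
  have "in_general_position p {1..4}"
    unfolding in_general_position_def
  proof (intro allI impI)
    fix T :: "nat set" assume T: "T \<subseteq> {1..4}" "card T = 3"
    obtain x y z where "T = {x, y, z}" "x \<noteq> y" "x \<noteq> z" "y \<noteq> z"
      using T(2) by (auto simp: card_3_iff)
    then show "\<not> collinear (p ` T)"
      using turn[of x y z] T(1) by (simp add: collinear_iff_turn_eq_0)
  qed
  moreover have "noncrossing p {e. e \<subseteq> {1..4} \<and> card e = 2}"
    unfolding noncrossing_def
  proof (intro ballI impI)
    fix e f :: "nat set"
    assume ef: "e \<in> {e. e \<subseteq> {1..4} \<and> card e = 2}" "f \<in> {e. e \<subseteq> {1..4} \<and> card e = 2}" "e \<inter> f = {}"
    obtain x y where e: "e = {x, y}" "x \<noteq> y" using ef(1) by (auto simp: card_2_iff)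
    obtain z w where f: "f = {z, w}" "z \<noteq> w" using ef(2) by (auto simp: card_2_iff)
    have V: "x \<in> {1..4}" "y \<in> {1..4}" "z \<in> {1..4}" "w \<in> {1..4}" using ef e f by auto
    have ne: "x \<noteq> z" "x \<noteq> w" "y \<noteq> z" "y \<noteq> w" using ef(3) e f by auto
    have "\<not> (sgn (turn (p x) (p y) (p z)) \<noteq> sgn (turn (p x) (p y) (p w)) \<and>
        sgn (turn (p z) (p w) (p x)) \<noteq> sgn (turn (p z) (p w) (p y)))"
      using V ne e(2) f(2) unfolding four by (elim insertE emptyE) (simp_all add: p_def turn_def)
    then have "closed_segment (p x) (p y) \<inter> closed_segment (p z) (p w) = {}"
      using segments_meet_iff[of "p x" "p y" "p z" "p w"] turn V ne e(2) f(2) by metis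
    then show "convex hull (p ` e) \<inter> convex hull (p ` f) = {}"
      using e f by (simp add: segment_convex_hull)
  qed
  ultimately show ?case by blast
next
  case (step m E \<Phi> F)
  then obtain p where gp: "in_general_position p {1..m}" and nc: "noncrossing p E" by blast
  note E = stacked_edges[OF step.hyps(1)] and \<Phi> = stacked_faces_triangles[OF step.hyps(1)]
  have m: "card {1..m} \<ge> 3" using stacked_ge_4[OF step.hyps(1)] by simp
  obtain Q where Q: "encloses p {1..m} \<Phi> Q"
    using stacked_encloses[OF step.hyps(1) gp nc] by blast
  obtain w where w: "\<And>x e. x \<in> F \<Longrightarrow> e \<in> E \<Longrightarrow> x \<notin> e \<Longrightarrow>
      closed_segment w (p x) \<inter> convex hull (p ` e) = {}"
    using stacking_position[OF gp m nc E \<Phi> Q step.hyps(2)] by blast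
  have "F \<in> triangles_of {1..m} E" using step.hyps(2) \<Phi> by blast
  note F = triangles_ofD[OF this]
  have nc': "noncrossing (p(Suc m := w)) (stack_edges (Suc m) F E)"
    by (rule noncrossing_stack_edges[OF nc _ _ F(1) w]) (use E in auto)
  have E': "e \<subseteq> {1..Suc m} \<and> card e = 2" if "e \<in> stack_edges (Suc m) F E" for e
    using stacked_edges[OF stacked.step[OF step.hyps]] that by blast
  obtain q where "in_general_position q {1..Suc m}" "noncrossing q (stack_edges (Suc m) F E)"
    using noncrossing_perturb[of "{1..Suc m}" "{()}" "\<lambda>_. stack_edges (Suc m) F E" "\<lambda>_. id" "p(Suc m := w)"]
      nc' E' by auto
  then show ?case by blast
qed

section \<open>Noncrossing placements and plane drawings\<close>

lemma straight_line_embedding_noncrossing: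
  assumes "straight_line_embedding (V, E) p"
  shows "noncrossing p E"
  unfolding noncrossing_def
proof (intro ballI impI)
  fix e f assume ef: "e \<in> E" "f \<in> E" "e \<inter> f = {}"
  show "convex hull (p ` e) \<inter> convex hull (p ` f) = {}"
  proof (cases "e = f")
    case True
    then show ?thesis using ef(3) by simp
  next
    case False
    then have "convex hull (p ` e) \<inter> convex hull (p ` f) = p ` (e \<inter> f)"
      using assms ef(1,2) unfolding straight_line_embedding_def plane_drawing_def by simp
    then show ?thesis using ef(3) by simp
  qed
qed

text \<open>Two edges with a common end span a nondegenerate triangle, so they share only that end;
  a further vertex on an edge would give a collinear triple.\<close>

lemma noncrossing_straight_line_embedding:
  assumes gp: "in_general_position p V" and V: "card V \<ge> 3"
    and E: "\<And>e. e \<in> E \<Longrightarrow> e \<subseteq> V \<and> card e = 2" and nc: "noncrossing p E"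
  shows "straight_line_embedding (V, E) p"
  unfolding straight_line_embedding_def plane_drawing_def case_prod_conv
proof (intro conjI ballI impI)
  show inj: "inj_on p V" by (rule general_position_inj_on[OF gp V])
  have on_edge: "i \<in> e" if ie: "e \<in> E" "i \<in> V" "p i \<in> convex hull (p ` e)" for i e
  proof -
    obtain y z where yz: "e = {y, z}" using E[OF ie(1)] by (auto simp: card_2_iff)
    then have "p i \<in> closed_segment (p y) (p z)" using ie by (simp add: segment_convex_hull)
    then show ?thesis
      using general_position_in_segment[OF gp _ _ V, of y z i] E[OF ie(1)] yz ie by blast
  qed
  fix e assume e: "e \<in> E"
  obtain x y where xy: "e = {x, y}" "x \<noteq> y" using E[OF e] by (auto simp: card_2_iff)
  have xyV: "x \<in> V" "y \<in> V" using E[OF e] xy by auto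
  have "p x \<noteq> p y" using inj xyV xy(2) by (auto simp: inj_on_def)
  then have "arc (linepath (p x) (p y))" by (rule arc_linepath)
  then show "\<exists>g. arc g \<and> {pathstart g, pathfinish g} = p ` e \<and> path_image g = convex hull (p ` e)"
    by (intro exI[of _ "linepath (p x) (p y)"]) (simp add: xy segment_convex_hull)
  show "convex hull (p ` e) \<inter> p ` V = p ` e"
    using on_edge[OF e] E[OF e] by (auto intro: hull_inc)
  fix f assume f: "f \<in> E" "e \<noteq> f"
  show "convex hull (p ` e) \<inter> convex hull (p ` f) = p ` (e \<inter> f)"
  proof (cases "e \<inter> f = {}")
    case True
    then show ?thesis using noncrossingD[OF nc e f(1)] by simp
  next
    case False
    obtain b where b: "b \<in> e" "b \<in> f" using False by blast
    obtain a where a: "e = {a, b}" "a \<noteq> b"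
      using b(1) xy by (metis doubleton_eq_iff insertE singletonD)
    obtain z w where zw: "f = {z, w}" "z \<noteq> w" using E[OF f(1)] by (auto simp: card_2_iff)
    obtain c where c: "f = {b, c}" "c \<noteq> b"
      using b(2) zw by (metis doubleton_eq_iff insertE singletonD)
    have "a \<noteq> c" using f(2) a c by (auto simp: insert_commute)
    moreover have "{a, b, c} \<subseteq> V" using E[OF e] E[OF f(1)] a c by auto
    ultimately have "\<not> collinear {p a, p b, p c}"
      using general_position_not_collinear[OF gp] a c by metis
    then have "closed_segment (p a) (p b) \<inter> closed_segment (p b) (p c) = {p b}"
      by (intro Int_closed_segment) blast
    moreover have "p ` (e \<inter> f) = {p b}" using a c \<open>a \<noteq> c\<close> by auto
    moreover have "p ` e = {p a, p b}" "p ` f = {p b, p c}" using a c by auto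
    ultimately show ?thesis by (simp only: segment_convex_hull)
  qed
qed

section \<open>Counting order types\<close>

lemma general_position_image_iff:
  assumes "inj_on p V"
  shows "general_position (p ` V) \<longleftrightarrow> in_general_position p V"
proof
  assume gp: "general_position (p ` V)"
  show "in_general_position p V"
    unfolding in_general_position_def
  proof (intro allI impI)
    fix T assume T: "T \<subseteq> V" "card T = 3"
    have "card (p ` T) = 3" using T card_image[OF inj_on_subset[OF assms T(1)]] by simp
    then show "\<not> collinear (p ` T)" using gp T(1) unfolding general_position_def by blast
  qed
next
  assume gp: "in_general_position p V"
  show "general_position (p ` V)"
    unfolding general_position_def
  proof (intro allI impI)
    fix S assume S: "S \<subseteq> p ` V" "card S = 3"
    obtain T where T: "T \<subseteq> V" "S = p ` T" using S(1) by (auto simp: subset_image_iff)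
    have "card T = 3" using S(2) T card_image[OF inj_on_subset[OF assms T(1)]] by simp
    then show "\<not> collinear S" using gp T unfolding in_general_position_def by blast
  qed
qed

lemma in_general_position_permute:
  assumes "in_general_position p V" "\<sigma> permutes V"
  shows "in_general_position (p \<circ> \<sigma>) V"
  unfolding in_general_position_def
proof (intro allI impI)
  fix T assume T: "T \<subseteq> V" "card T = 3"
  have "card (\<sigma> ` T) = 3"
    using T(2) card_image[OF inj_on_subset[OF permutes_inj[OF assms(2)]]] by auto
  moreover have "\<sigma> ` T \<subseteq> V" using T(1) permutes_image[OF assms(2)] by blast
  ultimately show "\<not> collinear ((p \<circ> \<sigma>) ` T)"
    using assms(1) unfolding in_general_position_def image_comp[symmetric] by blast
qed

lemma in_general_position_isomorphic:
  assumes gp: "in_general_position p V"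
    and iso: "\<And>i j k. i \<in> V \<Longrightarrow> j \<in> V \<Longrightarrow> k \<in> V \<Longrightarrow>
      orientation (p i) (p j) (p k) = orientation (q i) (q j) (q k)"
  shows "in_general_position q V"
  unfolding in_general_position_def
proof (intro allI impI)
  fix T assume T: "T \<subseteq> V" "card T = 3"
  obtain x y z where xyz: "T = {x, y, z}" "x \<noteq> y" "x \<noteq> z" "y \<noteq> z"
    using T(2) by (auto simp: card_3_iff)
  then have "turn (p x) (p y) (p z) \<noteq> 0" using general_position_turn[OF gp] T(1) by blast
  moreover have "sgn (turn (p x) (p y) (p z)) = sgn (turn (q x) (q y) (q z))"
    using iso[of x y z] xyz T(1) unfolding orientation_eq_sgn_turn by blast
  ultimately have "turn (q x) (q y) (q z) \<noteq> 0" by (metis sgn_eq_0_iff)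
  then show "\<not> collinear (q ` T)" using xyz by (simp add: collinear_iff_turn_eq_0)
qed

text \<open>An order type is fixed by its finite table of orientations. As \<open>card\<close> is 0
  on infinite sets, the upper bound in terms of \<open>t_s\<close> rests on this.\<close>

lemma finite_simple_labelled_order_types: "finite (simple_labelled_order_types n)"
proof -
  let ?V = "{1..n}"
  define tab where "tab p = (\<lambda>(i, j, k)\<in>?V \<times> ?V \<times> ?V. orientation (p i) (p j) (p k))" for p
  define cls where "cls f = {q \<in> labelled_point_sets n. f = tab q}" for f
  have tab_eq: "tab p = tab q \<longleftrightarrow> (\<forall>i\<in>?V. \<forall>j\<in>?V. \<forall>k\<in>?V.
      orientation (p i) (p j) (p k) = orientation (q i) (q j) (q k))" for p q
  proof
    assume eq: "tab p = tab q"
    show "\<forall>i\<in>?V. \<forall>j\<in>?V. \<forall>k\<in>?V. orientation (p i) (p j) (p k) = orientation (q i) (q j) (q k)"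
    proof (intro ballI)
      fix i j k assume "i \<in> ?V" "j \<in> ?V" "k \<in> ?V"
      then show "orientation (p i) (p j) (p k) = orientation (q i) (q j) (q k)"
        using fun_cong[OF eq, of "(i, j, k)"] unfolding tab_def by simp
    qed
  next
    assume "\<forall>i\<in>?V. \<forall>j\<in>?V. \<forall>k\<in>?V. orientation (p i) (p j) (p k) = orientation (q i) (q j) (q k)"
    then show "tab p = tab q" unfolding tab_def by (intro restrict_ext) auto
  qed
  have "simple_labelled_order_types n \<subseteq> cls ` ((?V \<times> ?V \<times> ?V) \<rightarrow>\<^sub>E {-1, 0, 1})"
  proof
    fix C assume "C \<in> simple_labelled_order_types n"
    then obtain p where p: "p \<in> labelled_point_sets n" "C = isomorphic_point_sets n `` {p}"
      unfolding simple_labelled_order_types_def by (auto elim: quotientE)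
    then have "C = cls (tab p)"
      unfolding cls_def isomorphic_point_sets_def tab_eq by blast
    moreover have "tab p \<in> (?V \<times> ?V \<times> ?V) \<rightarrow>\<^sub>E {-1, 0, 1}"
    proof -
      have "orientation a b c \<in> {-1, 0, 1}" for a b c
        unfolding orientation_def by (simp add: sgn_if)
      then show ?thesis
        unfolding tab_def by (intro restrict_PiE_iff[THEN iffD2] ballI) (auto simp del: insert_iff)
    qed
    ultimately show "C \<in> cls ` ((?V \<times> ?V \<times> ?V) \<rightarrow>\<^sub>E {-1, 0, 1})" by blast
  qed
  then show ?thesis by (rule finite_subset) (intro finite_imageI finite_PiE; simp)
qed

lemma stackings_edges: "E \<in> stackings n \<Longrightarrow> e \<in> E \<Longrightarrow> e \<subseteq> {1..n} \<and> card e = 2"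
  unfolding stackings_def using stacked_edges by blast

lemma stackings_unique:
  assumes "E \<in> stackings n" "E' \<in> stackings n" "in_general_position p {1..n}"
    "noncrossing p E" "noncrossing p E'"
  shows "E = E'"
  using assms stacked_unique unfolding stackings_def by blast

text \<open>The first embedding labels the points, and \<open>\<sigma> i\<close> translates the
  labels of embedding \<open>i\<close> into those of the first. Noncrossing is asserted for every
  member of the class \<open>C\<close>, so \<open>C\<close> and \<open>\<sigma>\<close> alone
  constrain the graphs.\<close>

lemma simultaneous_embedding_order_type:
  fixes g :: "nat \<Rightarrow> nat set set"
  assumes n: "n \<ge> 4" and k: "k \<ge> 1" and g: "\<And>i. i < k \<Longrightarrow> g i \<in> stackings n"
    and sim: "simultaneously_embeddable n ((\<lambda>i. ({1..n}, g i)) ` {..<k})"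
  obtains C \<sigma> where "C \<in> simple_labelled_order_types n"
    "\<And>i. i < k \<Longrightarrow> \<sigma> i permutes {1..n}" "\<sigma> 0 = id"
    "\<And>i q. i < k \<Longrightarrow> q \<in> C \<Longrightarrow> noncrossing (q \<circ> \<sigma> i) (g i)"
proof -
  let ?V = "{1..n}"
  have k0: "0 < k" using k by linarith
  obtain P where P: "finite P" "card P = n"
    and emb: "\<And>G. G \<in> (\<lambda>i. (?V, g i)) ` {..<k} \<Longrightarrow> \<exists>p. p ` fst G \<subseteq> P \<and> straight_line_embedding G p"
    using sim unfolding simultaneously_embeddable_def by blast
  have "\<exists>p. p ` ?V \<subseteq> P \<and> straight_line_embedding (?V, g i) p" if "i < k" for i
    using emb[of "(?V, g i)"] that by auto
  then obtain p where p: "\<And>i. i < k \<Longrightarrow> p i ` ?V \<subseteq> P"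
    "\<And>i. i < k \<Longrightarrow> straight_line_embedding (?V, g i) (p i)" by metis
  \<comment> \<open>\<open>P\<close> has exactly \<open>n\<close> points, so every embedding
    occupies all of them.\<close>
  have bij: "bij_betw (p i) ?V P" if "i < k" for i
  proof -
    have "inj_on (p i) ?V"
      using p(2)[OF that] unfolding straight_line_embedding_def plane_drawing_def by simp
    moreover from this have "p i ` ?V = P"
      using card_subset_eq[OF P(1) p(1)[OF that]] P(2) by (simp add: card_image)
    ultimately show ?thesis unfolding bij_betw_def by blast
  qed
  define \<sigma> where "\<sigma> i = (if i = 0 then id else (\<lambda>x. if x \<in> ?V then inv_into ?V (p 0) (p i x) else x))" for i
  have perm: "\<sigma> i permutes ?V" if "i < k" for i
  proof (cases "i = 0")
    case True
    then show ?thesis unfolding \<sigma>_def by (simp add: permutes_id)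
  next
    case False
    have "bij_betw (inv_into ?V (p 0) \<circ> p i) ?V ?V"
      by (rule bij_betw_trans[OF bij[OF that] bij_betw_inv_into[OF bij[OF k0]]])
    then have "bij_betw (\<sigma> i) ?V ?V"
      using False by (subst bij_betw_cong[of _ _ "inv_into ?V (p 0) \<circ> p i"]) (auto simp: \<sigma>_def)
    then show ?thesis using False by (intro bij_imp_permutes) (auto simp: \<sigma>_def)
  qed
  have comp: "(p 0 \<circ> \<sigma> i) x = p i x" if "i < k" "x \<in> ?V" for i x
  proof (cases "i = 0")
    case False
    have "p i x \<in> p 0 ` ?V"
      using bij[OF that(1)] bij[OF k0] that(2) unfolding bij_betw_def by auto
    then show ?thesis using False that(2) unfolding \<sigma>_def by (simp add: f_inv_into_f)
  qed (simp add: \<sigma>_def)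
  have edges: "e \<subseteq> ?V \<and> card e = 2" if "i < k" "e \<in> g i" for i e
    using stackings_edges[OF g[OF that(1)] that(2)] .
  have nc: "noncrossing (p 0 \<circ> \<sigma> i) (g i)" if "i < k" for i
    using straight_line_embedding_noncrossing[OF p(2)[OF that]]
      noncrossing_cong[of ?V "p 0 \<circ> \<sigma> i" "p i" "g i"] comp[OF that] edges[OF that] by blast
  obtain q where q: "in_general_position q ?V" "\<And>i. i < k \<Longrightarrow> noncrossing (q \<circ> \<sigma> i) (g i)"
    using noncrossing_perturb[of ?V "{..<k}" g \<sigma> "p 0"] edges nc permutes_image[OF perm]
    by (metis finite_atLeastAtMost finite_lessThan lessThan_iff order_refl)
  \<comment> \<open>Labelled point sets are extensional functions, hence the restriction to the
    labels.\<close>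
  define r where "r = restrict q ?V"
  have rq: "r i = q i" if "i \<in> ?V" for i using that unfolding r_def by simp
  have gpr: "in_general_position r ?V" using q(1) in_general_position_cong[of ?V r q] rq by blast
  have inj: "inj_on r ?V" using general_position_inj_on[OF gpr] n by simp
  have rl: "r \<in> labelled_point_sets n" using inj unfolding labelled_point_sets_def r_def by auto
  define C where "C = isomorphic_point_sets n `` {r}"
  have C: "C \<in> simple_labelled_order_types n"
    unfolding simple_labelled_order_types_def C_def
    by (rule quotientI) (use rl gpr general_position_image_iff[OF inj] in simp)
  have "noncrossing (s \<circ> \<sigma> i) (g i)" if "i < k" "s \<in> C" for i s
  proof -
    have iso: "orientation (r x) (r y) (r z) = orientation (s x) (s y) (s z)"
      if "x \<in> ?V" "y \<in> ?V" "z \<in> ?V" for x y z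
      using \<open>s \<in> C\<close> that unfolding C_def isomorphic_point_sets_def by auto
    have gps: "in_general_position s ?V" using in_general_position_isomorphic[OF gpr iso] .
    have im: "\<sigma> i x \<in> ?V" if "x \<in> ?V" for x
      using permutes_in_image[OF perm[OF \<open>i < k\<close>]] that by blast
    have "noncrossing (r \<circ> \<sigma> i) (g i)"
      using q(2)[OF that(1)] noncrossing_cong[of ?V "r \<circ> \<sigma> i" "q \<circ> \<sigma> i" "g i"]
        edges[OF that(1)] rq im by simp
    then show ?thesis
      by (rule noncrossing_isomorphic[OF in_general_position_permute[OF gpr perm[OF that(1)]]
          in_general_position_permute[OF gps perm[OF that(1)]] edges[OF that(1)], rotated 2])
        (use iso im in auto)
  qed
  then show ?thesis using that[of C \<sigma>] C perm unfolding \<sigma>_def by auto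
qed

lemma order_type_general_position:
  assumes "C \<in> simple_labelled_order_types n" "n \<ge> 3"
  obtains q where "q \<in> C" "in_general_position q {1..n}"
proof -
  obtain p where p: "p \<in> labelled_point_sets n" "general_position (p ` {1..n})"
    "C = isomorphic_point_sets n `` {p}"
    using assms(1) unfolding simple_labelled_order_types_def by (auto elim: quotientE)
  then have "p \<in> C" unfolding isomorphic_point_sets_def by auto
  moreover have "in_general_position p {1..n}"
    using p general_position_image_iff[of p "{1..n}"] unfolding labelled_point_sets_def by auto
  ultimately show ?thesis using that by blast
qed

text \<open>Tuples are indexed and may repeat graphs. The first permutation is the identity and is
  not recorded, which leaves \<open>j\<close> factors \<open>fact n\<close> for \<open>Suc j\<close>
  graphs.\<close>

lemma all_simultaneous_bound:
  assumes n: "n \<ge> 4"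
    and sim: "\<And>g :: nat \<Rightarrow> nat set set. (\<And>i. i < Suc j \<Longrightarrow> g i \<in> stackings n) \<Longrightarrow>
      simultaneously_embeddable n ((\<lambda>i. ({1..n}, g i)) ` {..<Suc j})"
  shows "card (stackings n) ^ Suc j \<le> t_s n * fact n ^ j"
proof -
  let ?V = "{1..n}" and ?G = "{..<Suc j} \<rightarrow>\<^sub>E stackings n"
  let ?D = "simple_labelled_order_types n \<times> ({1..<Suc j} \<rightarrow>\<^sub>E {\<sigma>. \<sigma> permutes {1..n}})"
  define fits where "fits g d \<longleftrightarrow> d \<in> ?D \<and> (\<forall>q\<in>fst d. noncrossing q (g 0)) \<and>
    (\<forall>i\<in>{1..<Suc j}. \<forall>q\<in>fst d. noncrossing (q \<circ> snd d i) (g i))" for g d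
  have "\<exists>d. fits g d" if "g \<in> ?G" for g
  proof -
    have g: "g i \<in> stackings n" if "i < Suc j" for i using \<open>g \<in> ?G\<close> that by auto
    have S: "simultaneously_embeddable n ((\<lambda>i. ({1..n}, g i)) ` {..<Suc j})"
      using g by (rule sim)
    have "1 \<le> Suc j" by simp
    from simultaneous_embedding_order_type[OF n this g S]
    obtain C \<sigma> where C: "C \<in> simple_labelled_order_types n"
      "\<And>i. i < Suc j \<Longrightarrow> \<sigma> i permutes {1..n}" "\<sigma> 0 = id"
      "\<And>i q. i < Suc j \<Longrightarrow> q \<in> C \<Longrightarrow> noncrossing (q \<circ> \<sigma> i) (g i)"
      by blast
    have "fits g (C, restrict \<sigma> {1..<Suc j})"
      unfolding fits_def using C(1,2) C(4)[of 0] C(3) C(4) by auto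
    then show ?thesis by blast
  qed
  then obtain h where h: "\<And>g. g \<in> ?G \<Longrightarrow> fits g (h g)" by metis
  have "inj_on h ?G"
  proof (rule inj_onI)
    fix g g' assume gg: "g \<in> ?G" "g' \<in> ?G" "h g = h g'"
    obtain C \<sigma> where d: "h g = (C, \<sigma>)" by (cases "h g")
    have f: "fits g (C, \<sigma>)" "fits g' (C, \<sigma>)" using h gg d by metis+
    have C: "C \<in> simple_labelled_order_types n" and \<sigma>: "\<And>i. i \<in> {1..<Suc j} \<Longrightarrow> \<sigma> i permutes ?V"
      using f(1) unfolding fits_def by auto
    \<comment> \<open>One representative in general position decodes the data: composed with each
      recorded permutation, it carries at most one stacked triangulation.\<close>
    obtain q where q: "q \<in> C" "in_general_position q ?V"
      using order_type_general_position[OF C] n by auto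
    show "g = g'"
    proof (rule PiE_ext[OF gg(1,2)])
      fix i assume i: "i \<in> {..<Suc j}"
      then have gi: "g i \<in> stackings n" "g' i \<in> stackings n" using gg by auto
      show "g i = g' i"
      proof (cases "i = 0")
        case True
        then have "noncrossing q (g i)" "noncrossing q (g' i)"
          using f q(1) unfolding fits_def by auto
        then show ?thesis using stackings_unique[OF gi q(2)] by blast
      next
        case False
        then have i1: "i \<in> {1..<Suc j}" using i by auto
        then have "noncrossing (q \<circ> \<sigma> i) (g i)" "noncrossing (q \<circ> \<sigma> i) (g' i)"
          using f q(1) unfolding fits_def by auto
        then show ?thesis
          using stackings_unique[OF gi in_general_position_permute[OF q(2) \<sigma>[OF i1]]] by blast
      qed
    qed
  qed
  moreover have "h ` ?G \<subseteq> ?D" using h unfolding fits_def by blast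
  moreover have "finite ?D"
    by (intro finite_cartesian_product finite_simple_labelled_order_types finite_PiE finite_permutations) simp_all
  ultimately have "card ?G \<le> card ?D" by (rule card_inj_on_le)
  also have "card ?G = card (stackings n) ^ Suc j" by (simp add: card_PiE)
  also have "card ?D = t_s n * fact n ^ j"
    by (simp add: card_cartesian_product card_PiE t_s_def card_permutations)
  finally show ?thesis .
qed

lemma stackings_planar:
  assumes "E \<in> stackings n"
  obtains p where "straight_line_embedding ({1..n}, E) p"
proof -
  obtain \<Phi> where st: "stacked n E \<Phi>" using assms unfolding stackings_def by blast
  obtain p where "in_general_position p {1..n}" "noncrossing p E"
    using stacked_realizable[OF st] by blast
  then have "straight_line_embedding ({1..n}, E) p"
    using stacked_edges[OF st] stacked_ge_4[OF st]
    by (intro noncrossing_straight_line_embedding) auto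
  then show ?thesis using that by blast
qed

text \<open>A single planar graph is simultaneously embeddable, so the counting bound applies with
  \<open>j = 0\<close>. This makes the quotient in the theorem nonnegative.\<close>

lemma card_stackings_le_t_s:
  assumes n: "n \<ge> 4"
  shows "card (stackings n) \<le> t_s n"
proof -
  have "card (stackings n) ^ Suc 0 \<le> t_s n * fact n ^ 0"
  proof (rule all_simultaneous_bound[OF n])
    fix g :: "nat \<Rightarrow> nat set set" assume "\<And>i. i < Suc 0 \<Longrightarrow> g i \<in> stackings n"
    then obtain p where p: "straight_line_embedding ({1..n}, g 0) p"
      using stackings_planar by blast
    then have "inj_on p {1..n}"
      unfolding straight_line_embedding_def plane_drawing_def by simp
    then have "card (p ` {1..n}) = n" by (simp add: card_image)
    then show "simultaneously_embeddable n ((\<lambda>i. ({1..n}, g i)) ` {..<Suc 0})"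
      unfolding simultaneously_embeddable_def using p
      by (intro exI[of _ "p ` {1..n}"]) (auto simp: lessThan_Suc)
  qed
  then show ?thesis by simp
qed

section \<open>From the counting inequality to the bound on \<open>conflict_sigma\<close>\<close>

lemma conflict_sigma_le:
  assumes n: "n \<ge> 4" and less: "t_s n * fact n ^ j < card (stackings n) ^ Suc j"
  shows "conflict_sigma n \<le> enat (Suc j)"
proof -
  have "\<not> card (stackings n) ^ Suc j \<le> t_s n * fact n ^ j" using less by simp
  then obtain g where g: "\<And>i. i < Suc j \<Longrightarrow> g i \<in> stackings n"
    and nsim: "\<not> simultaneously_embeddable n ((\<lambda>i. ({1..n}, g i)) ` {..<Suc j})"
    using all_simultaneous_bound[OF n] by blast
  let ?G = "(\<lambda>i. ({1..n}, g i)) ` {..<Suc j}"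
  have "planar_graph ({1..n}, g i)" if i: "i < Suc j" for i
  proof -
    obtain p where "straight_line_embedding ({1..n}, g i) p"
      using stackings_planar[OF g[OF i]] by blast
    then show ?thesis
      using stackings_edges[OF g[OF i]]
      unfolding planar_graph_def simple_graph_def straight_line_embedding_def by auto
  qed
  then have "conflict_collection n ?G" using nsim unfolding conflict_collection_def by auto
  then have "conflict_sigma n \<le> enat (card ?G)"
    unfolding conflict_sigma_def by (intro INF_lower) simp
  \<comment> \<open>The tuple may repeat a graph, which only shrinks the collection.\<close>
  also have "enat (card ?G) \<le> enat (Suc j)" using card_image_le[of "{..<Suc j}" "\<lambda>i. ({1..n}, g i)"] by simp
  finally show ?thesis .
qed

text \<open>Makes the denominator positive, and is the origin of the bound 16: there it reads 53760
  < 65536, while for n = 15 the left side 43680 exceeds 32768.\<close>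

lemma cubic_less_power_two:
  "n \<ge> 16 \<Longrightarrow> 16 * real n * (real n - 1) * (real n - 2) < 2 ^ n"
proof (induction n rule: dec_induct)
  case (step n)
  have "16 * real (Suc n) * (real (Suc n) - 1) * (real (Suc n) - 2) =
      16 * real n * (real n - 1) * (real n + 1)" by (simp add: algebra_simps)
  \<comment> \<open>Uses n + 1 \<le> 2 (n - 2), valid from n = 5 on.\<close>
  also have "\<dots> \<le> 16 * real n * (real n - 1) * (2 * (real n - 2))"
    using step.hyps by (intro mult_left_mono) auto
  also have "\<dots> = 2 * (16 * real n * (real n - 1) * (real n - 2))" by simp
  also have "\<dots> < 2 ^ Suc n" using step.IH by simp
  finally show ?case .
qed simp

theorem theorem4:
  fixes n :: nat
  assumes "n \<ge> 16"
  shows "ereal_of_enat (conflict_sigma n) \<le>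
    ereal (of_int (\<lfloor>(log 2 (real (t_s n)) - (real n - 4) - log 2 (fact (n - 3))) /
                    (real n - log 2 (16 * real n * (real n - 1) * (real n - 2)))\<rfloor> + 2))"
proof -
  define N where "N = card (stackings n)"
  define D where "D = real n - log 2 (16 * real n * (real n - 1) * (real n - 2))"
  define X where "X = (log 2 (real (t_s n)) - (real n - 4) - log 2 (fact (n - 3))) / D"
  have ge4: "n \<ge> 4" using assms by simp
  define m where "m = n - 4"
  have m: "n = m + 4" using assms unfolding m_def by simp
  have N: "real N = 2 ^ m * fact (n - 3)"
    unfolding N_def card_stackings[OF ge4] m_def
    by (simp only: of_nat_mult of_nat_power of_nat_fact of_nat_numeral)
  have "log 2 (real N) = log 2 (2 ^ m) + log 2 (fact (n - 3))"
    unfolding N by (rule log_mult_pos) simp_all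
  then have logN: "log 2 (real N) = (real n - 4) + log 2 (fact (n - 3))"
    using m by (simp add: log_nat_power)
  have tN: "real N \<le> real (t_s n)" using card_stackings_le_t_s[OF ge4] unfolding N_def by simp
  have N0: "0 < real N" unfolding N by simp
  then have t0: "0 < real (t_s n)" using tN by simp
  have prod0: "0 < 16 * real n * (real n - 1) * (real n - 2)" using assms by simp
  have "log 2 (16 * real n * (real n - 1) * (real n - 2)) < log 2 (2 ^ n)"
    using cubic_less_power_two[OF assms] prod0 by (subst log_less_cancel_iff) auto
  then have D0: "D > 0" unfolding D_def by (simp add: log_nat_power)
  \<comment> \<open>Splitting off the three largest factors of n! leaves the factor (n-3)! that it
    shares with \<open>N\<close>; the 16 makes up for the exponent n - 4 in place of n.\<close>
  have "fact n = real n * (real n - 1) * (real n - 2) * fact (n - 3)"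
    unfolding m by (simp add: eval_nat_numeral algebra_simps)
  then have "16 * fact n = (16 * real n * (real n - 1) * (real n - 2)) * fact (n - 3)" by simp
  then have "log 2 (16 * fact n) = log 2 (16 * real n * (real n - 1) * (real n - 2)) + log 2 (fact (n - 3))"
    using prod0 by (simp only: log_mult_pos fact_gt_zero)
  moreover have "log 2 (16 * fact n) = 4 + log 2 (fact n)"
  proof -
    have "log 2 (16 :: real) = 4" using log_nat_power[of 2 2 4] by simp
    then show ?thesis by (simp add: log_mult)
  qed
  ultimately have D: "D = log 2 (real N) - log 2 (fact n)" unfolding D_def logN by simp
  have X: "X = (log 2 (real (t_s n)) - log 2 (real N)) / D" unfolding X_def logN by simp
  have "log 2 (real N) \<le> log 2 (real (t_s n))" using tN N0 t0 by simp
  then have "X \<ge> 0" using D0 unfolding X by simp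
  \<comment> \<open>\<open>nat\<close> is exact because \<open>X\<close> is nonnegative, and
    \<open>j\<close> is the least natural number above \<open>X\<close>; with \<open>Suc j\<close>
    graphs the bound becomes the floor plus 2.\<close>
  define j where "j = nat \<lfloor>X\<rfloor> + 1"
  have j: "real j = of_int \<lfloor>X\<rfloor> + 1" using \<open>X \<ge> 0\<close> unfolding j_def by simp
  have "X < real j" unfolding j by linarith
  then have "log 2 (real (t_s n)) - log 2 (real N) < real j * D"
    unfolding X using D0 by (simp add: pos_divide_less_eq)
  then have "log 2 (real (t_s n)) + real j * log 2 (fact n) < real (Suc j) * log 2 (real N)"
    unfolding D by (simp add: algebra_simps)
  then have "log 2 (real (t_s n) * fact n ^ j) < log 2 (real N ^ Suc j)"
    using t0 N0 by (simp add: log_mult log_nat_power del: power_Suc of_nat_Suc)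
  then have "real (t_s n) * fact n ^ j < real N ^ Suc j"
    using t0 N0 by (subst (asm) log_less_cancel_iff) auto
  then have "real (t_s n * fact n ^ j) < real (N ^ Suc j)" by simp
  then have "t_s n * fact n ^ j < card (stackings n) ^ Suc j"
    unfolding N_def by (simp only: of_nat_less_iff)
  then have "conflict_sigma n \<le> enat (Suc j)" by (rule conflict_sigma_le[OF ge4])
  then have "ereal_of_enat (conflict_sigma n) \<le> ereal_of_enat (enat (Suc j))"
    by (simp only: ereal_of_enat_le_iff)
  also have "\<dots> = ereal (of_int (\<lfloor>X\<rfloor> + 2))" using j by simp
  finally show ?thesis unfolding X_def D_def .
qed

end
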